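(* Let $L$ be a number field and let $W=\{w_1,\dots,w_m\}\subset O_L^*$ be such that each $w_i$ defines a class in $(O_L/4O_L)^*$ that is a square, and no non-trivial product of the $w_i$ lies in $(O_L^* )^2$. Then $N=L(\sqrt{w_1},\dots,\sqrt{w_m})$ satisfies $\delta(N)=\delta(L)$. If moreover each $w_i\equiv 1\pmod{4O_L}$, then $O_N$ is the free $O_L$-module on the elements $\eta_T=\prod_{i\in T}\frac{1+\sqrt{w_i}}{2}$, $T$ ranging over all subsets of $\{1,\dots,m\}$.
   Context: $\delta(K)=\Delta(K)^{1/n(K)}$ denotes the root discriminant of a number field $K$, where $\Delta(K)$ is the absolute value of the discriminant and $n(K)$ the degree. *)

theory Defs
  imports
    Complex_Main
    "HOL-Computational_Algebra.Polynomial"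
    "Jordan_Normal_Form.Determinant"
begin

text \<open>
  All fields live inside an arbitrary ambient field of characteristic 0, which is
  regarded as a vector space over the rationals; a number field is a subfield of it of finite
  dimension over the rationals.
\<close>

global_interpretation rat_vec:
  vector_space "\<lambda>(q::rat) (x::'a::field_char_0). of_rat q * x"
  by unfold_locales (simp_all add: of_rat_add of_rat_mult algebra_simps)

definition is_subfield :: "'a::field set \<Rightarrow> bool" where
  "is_subfield K \<longleftrightarrow> 0 \<in> K \<and> 1 \<in> K \<and>
     (\<forall>x\<in>K. \<forall>y\<in>K. x + y \<in> K \<and> x * y \<in> K) \<and> (\<forall>x\<in>K. - x \<in> K \<and> inverse x \<in> K)"

definition number_field :: "'a::field_char_0 set \<Rightarrow> bool" where
  "number_field K \<longleftrightarrow> is_subfield K \<and> (\<exists>B. finite B \<and> rat_vec.span B = K)"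

definition degree_of :: "'a::field_char_0 set \<Rightarrow> nat" where
  "degree_of K = rat_vec.dim K"

definition adjoin :: "'a::field set \<Rightarrow> 'a set \<Rightarrow> 'a set" where
  "adjoin K S = \<Inter> {F. is_subfield F \<and> K \<subseteq> F \<and> S \<subseteq> F}"

definition ring_of_integers :: "'a::field_char_0 set \<Rightarrow> 'a set" where
  "ring_of_integers K = {x \<in> K. algebraic_int x}"

definition unit_group :: "'a::comm_ring_1 set \<Rightarrow> 'a set" where
  "unit_group R = {u \<in> R. \<exists>v\<in>R. u * v = 1}"

definition cong_mod :: "'a::comm_ring_1 set \<Rightarrow> 'a \<Rightarrow> 'a \<Rightarrow> 'a \<Rightarrow> bool" where
  "cong_mod R a x y \<longleftrightarrow> (\<exists>z\<in>R. x - y = a * z)"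

text \<open>The class of \<open>x\<close> in \<open>R/aR\<close> is the square of an element of the unit group of \<open>R/aR\<close>
  (the class of \<open>u\<close>, with inverse the class of \<open>v\<close>).\<close>

definition square_unit_class :: "'a::comm_ring_1 set \<Rightarrow> 'a \<Rightarrow> 'a \<Rightarrow> bool" where
  "square_unit_class R a x \<longleftrightarrow>
     (\<exists>u\<in>R. (\<exists>v\<in>R. cong_mod R a (u * v) 1) \<and> cong_mod R a x (u ^ 2))"

text \<open>For a finite index set \<open>I\<close>: \<open>M\<close> is the free \<open>R\<close>-module on the family \<open>e\<close> indexed by \<open>I\<close>.\<close>

definition free_module_on ::
    "'a::comm_ring_1 set \<Rightarrow> 'a set \<Rightarrow> 'i set \<Rightarrow> ('i \<Rightarrow> 'a) \<Rightarrow> bool" where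
  "free_module_on R M I e \<longleftrightarrow>
     M = {\<Sum>i\<in>I. c i * e i | c. \<forall>i\<in>I. c i \<in> R} \<and>
     (\<forall>c. (\<forall>i\<in>I. c i \<in> R) \<and> (\<Sum>i\<in>I. c i * e i) = 0 \<longrightarrow> (\<forall>i\<in>I. c i = 0))"

text \<open>The trace of \<open>K\<close> over the rationals: the trace of multiplication by \<open>x\<close>, computed in a rational
  basis of \<open>K\<close>. Neither it nor the discriminant depends on the basis chosen.\<close>

definition field_trace :: "'a::field_char_0 set \<Rightarrow> 'a \<Rightarrow> rat" where
  "field_trace K x =
     (let B = (SOME B. rat_vec.independent B \<and> rat_vec.span B = K)
      in \<Sum>b\<in>B. rat_vec.representation B (x * b) b)"

definition integral_basis :: "'a::field_char_0 set \<Rightarrow> (nat \<Rightarrow> 'a) \<Rightarrow> bool" where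
  "integral_basis K b \<longleftrightarrow> free_module_on \<int> (ring_of_integers K) {..<degree_of K} b"

definition discriminant :: "'a::field_char_0 set \<Rightarrow> rat" where
  "discriminant K =
     (let b = (SOME b. integral_basis K b)
      in det (mat (degree_of K) (degree_of K) (\<lambda>(i, j). field_trace K (b i * b j))))"

definition root_discriminant :: "'a::field_char_0 set \<Rightarrow> real" where
  "root_discriminant K = real_of_rat \<bar>discriminant K\<bar> powr (1 / real (degree_of K))"

end

theory Submission
  imports Defs "Jordan_Normal_Form.Schur_Decomposition"
begin

text \<open>
  Adjoin the square roots one at a time. If \<open>K\<close> is a number field and \<open>s\<^sup>2 = w\<close> is a unit congruent to
  \<open>u\<^sup>2\<close> modulo \<open>4\<close>, then \<open>\<eta> = (u + s) / 2\<close> is integral, and since \<open>s\<close> is a unit, comparing an integer of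
  \<open>K(s)\<close> with its conjugate shows that \<open>1, \<eta>\<close> is a basis of the integers of \<open>K(s)\<close> over those of \<open>K\<close>.
  If \<open>b\<close> is an integral basis of \<open>K\<close>, then the Gram determinant of the trace form in the basis \<open>b, b s\<close>
  is \<open>4\<^sup>n N(w) \<Delta>\<^sup>2\<close> with \<open>N(w) = \<plusminus>1\<close>, where \<open>\<Delta>\<close> is that of \<open>b\<close>, and passing to the integral basis
  \<open>b, b \<eta>\<close> removes the factor \<open>4\<^sup>n\<close>. Hence the discriminant is squared up to sign while
  the degree doubles. That \<open>s\<close> does not lie in \<open>K\<close> is Kummer theory: a square of \<open>L(\<surd>w\<^sub>1, \<dots>, \<surd>w\<^sub>k)\<close> in \<open>L\<close> is a square of \<open>L\<close> times a
  product of some \<open>w\<^sub>i\<close>.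
\<close>

section \<open>Algebraic integers\<close>

text \<open>Over a general base, \<open>O_K\<close> need not be a principal ideal domain, and an
  extension of rings of integers need not have a relative basis. The congruence modulo 4 supplies an
  explicit one, \<open>1, \<eta>\<close>, so it suffices to work with absolute discriminants. The
  detour through \<open>b, b s\<close> is taken because the trace of \<open>x + y s\<close> over the
  rationals is \<open>2 Tr(x)\<close>: the Gram matrix is block diagonal for \<open>b, b s\<close>,
  but in general not for \<open>b, b \<eta>\<close>. The factor \<open>4^n\<close> is the square of
  the index \<open>2^n\<close> of the first lattice in the second. The discriminant is defined
  through some integral basis, so integral bases must be shown to exist; the argument minimises
  \<open>\<bar>gram_det\<bar>\<close>, which needs integral traces, and these in turn need the ring
  structure of the algebraic integers. Kummer theory yields squares in \<open>L\<close>, whereas the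
  hypothesis excludes squares of units only; the gap closes because a square root in
  \<open>L\<close> of a unit of \<open>O_L\<close> is itself a unit.\<close>

interpretation int_module: Modules.module "\<lambda>(k::int) (x::'a::comm_ring_1). of_int k * x"
  by unfold_locales (simp_all add: algebra_simps)

text \<open>The characteristic polynomial of an integer matrix is monic with integer
  coefficients.\<close>

lemma algebraic_int_eigenvalue:
  fixes z :: "'a::field_char_0" and A :: "int mat"
  assumes A: "A \<in> carrier_mat n n" and "eigenvalue (map_mat of_int A) z"
  shows "algebraic_int z"
proof -
  have "poly (char_poly (map_mat of_int A)) z = 0"
    using eigenvalue_root_char_poly[of "map_mat of_int A" n z] assms by auto
  then have "poly (map_poly of_int (char_poly A)) z = 0"
    using of_int_hom.char_poly_hom[OF A, where 'a = 'a] by simp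
  moreover have "lead_coeff (char_poly A) = 1"
    using degree_monic_char_poly[OF A] by simp
  ultimately show ?thesis
    unfolding algebraic_int_altdef_ipoly by blast
qed

text \<open>The determinant trick: multiplication by \<open>z\<close> on the generators is described
  by an integer matrix, and the vector of the generators themselves is an eigenvector of it for
  \<open>z\<close>. Stability is asked for on generators only, and a nonzero generator makes that
  vector nonzero.\<close>

lemma algebraic_int_if_stable_span:
  fixes z :: "'a::field_char_0"
  assumes fin: "finite S" and nz: "\<exists>v\<in>S. v \<noteq> 0"
    and stable: "\<And>v. v \<in> S \<Longrightarrow> z * v \<in> int_module.span S"
  shows "algebraic_int z"
proof -
  define n where "n = card S"
  obtain f where f: "bij_betw f {0..<n} S"
    using ex_bij_betw_nat_finite[OF fin] unfolding n_def by blast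
  have "\<exists>u. (\<Sum>v\<in>S. of_int (u v) * v) = z * f i" if "i < n" for i
  proof -
    have "f i \<in> S" using f that by (auto simp: bij_betw_def)
    from stable[OF this] show ?thesis
      unfolding int_module.span_finite[OF fin] by auto
  qed
  then obtain u where u: "\<And>i. i < n \<Longrightarrow> (\<Sum>v\<in>S. of_int (u i v) * v) = z * f i"
    by metis
  define A where "A = mat n n (\<lambda>(i, j). u i (f j))"
  have "map_mat of_int A *\<^sub>v vec n f = z \<cdot>\<^sub>v vec n f"
  proof (rule eq_vecI)
    fix i assume "i < dim_vec (z \<cdot>\<^sub>v vec n f)"
    then have i: "i < n" by simp
    have "(map_mat of_int A *\<^sub>v vec n f) $ i = (\<Sum>j=0..<n. of_int (u i (f j)) * f j)"
      using i by (simp add: A_def scalar_prod_def)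
    also have "\<dots> = (\<Sum>v\<in>S. of_int (u i v) * v)"
      using sum.reindex_bij_betw[OF f, of "\<lambda>v. of_int (u i v) * v"] by simp
    finally show "(map_mat of_int A *\<^sub>v vec n f) $ i = (z \<cdot>\<^sub>v vec n f) $ i"
      using u i by simp
  qed (simp add: A_def)
  moreover have "vec n f \<noteq> 0\<^sub>v n"
  proof
    assume eq: "vec n f = 0\<^sub>v n"
    have "f i = 0" if "i < n" for i
      using arg_cong[OF eq, of "\<lambda>v. v $ i"] that by simp
    then show False
      using nz f by (auto simp: bij_betw_def)
  qed
  ultimately have "eigenvalue (map_mat of_int A) z"
    unfolding eigenvalue_def eigenvector_def by (intro exI[of _ "vec n f"]) (auto simp: A_def)
  moreover have "A \<in> carrier_mat n n" by (simp add: A_def)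
  ultimately show ?thesis
    using algebraic_int_eigenvalue by blast
qed

lemma algebraic_intE:
  fixes x :: "'a::field_char_0"
  assumes "algebraic_int x"
  obtains d c where "d > 0" "x ^ d = (\<Sum>k<d. of_int (c k) * x ^ k)"
proof -
  obtain p where p: "poly (map_poly of_int p) x = 0" "lead_coeff p = 1"
    using assms unfolding algebraic_int_altdef_ipoly by blast
  define d where "d = degree p"
  have deg: "degree (map_poly (of_int :: int \<Rightarrow> 'a) p) = d"
    by (simp add: d_def of_int_hom.degree_map_poly_hom)
  \<comment> \<open>A monic constant polynomial is 1 and has no root. Positivity later guarantees
    that the monomial 1 is among the generators.\<close>
  have "d > 0"
  proof (rule ccontr)
    assume "\<not> d > 0"
    then obtain a where "p = [:a:]" unfolding d_def by (metis degree_eq_zeroE gr0I)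
    then show False using p by simp
  qed
  moreover have eq: "(\<Sum>k\<le>d. of_int (coeff p k) * x ^ k) = 0"
    using p(1) unfolding poly_altdef deg by (simp add: coeff_map_poly)
  then have "x ^ d = (\<Sum>k<d. of_int (- coeff p k) * x ^ k)"
  proof -
    have "(\<Sum>k\<le>d. of_int (coeff p k) * x ^ k) = (\<Sum>k<d. of_int (coeff p k) * x ^ k) + x ^ d"
      using p(2) unfolding d_def by (subst lessThan_Suc_atMost[symmetric]) simp
    then have "(\<Sum>k<d. of_int (coeff p k) * x ^ k) + x ^ d = 0" using eq by simp
    then show ?thesis by (simp add: sum_negf add_eq_0_iff)
  qed
  ultimately show ?thesis by (rule that)
qed

text \<open>The monomials \<open>x\<^sup>i y\<^sup>j\<close> with bounded exponents span a lattice which both \<open>x\<close> and \<open>y\<close> preserve.\<close>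

lemma algebraic_int_common_stable_span:
  fixes x y :: "'a::field_char_0"
  assumes "algebraic_int x" "algebraic_int y"
  obtains S where "finite S" "\<exists>v\<in>S. v \<noteq> 0"
    "\<And>v. v \<in> int_module.span S \<Longrightarrow> x * v \<in> int_module.span S"
    "\<And>v. v \<in> int_module.span S \<Longrightarrow> y * v \<in> int_module.span S"
proof -
  obtain d c where d: "d > 0" "x ^ d = (\<Sum>k<d. of_int (c k) * x ^ k)"
    using assms(1) by (rule algebraic_intE)
  obtain e b where e: "e > 0" "y ^ e = (\<Sum>k<e. of_int (b k) * y ^ k)"
    using assms(2) by (rule algebraic_intE)
  define S where "S = (\<lambda>(i, j). x ^ i * y ^ j) ` ({..<d} \<times> {..<e})"
  have S: "x ^ i * y ^ j \<in> S" if "i < d" "j < e" for i j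
    using that by (auto simp: S_def)
  have x_stable: "x * v \<in> int_module.span S" if v: "v \<in> S" for v
  proof -
    obtain i j where ij: "i < d" "j < e" "v = x ^ i * y ^ j"
      using v by (auto simp: S_def)
    \<comment> \<open>Only the top exponent leaves the range, and the monic relation for
      \<open>x\<close> brings it back.\<close>
    show ?thesis
    proof (cases "Suc i = d")
      case True
      then have "x * v = x ^ d * y ^ j" using ij by auto
      also have "\<dots> = (\<Sum>k<d. of_int (c k) * (x ^ k * y ^ j))"
        by (simp add: d(2) sum_distrib_right mult.assoc)
      also have "\<dots> \<in> int_module.span S"
        using S ij by (intro int_module.span_sum int_module.span_scale int_module.span_base) auto
      finally show ?thesis .
    next
      case False
      then show ?thesis
        using S[of "Suc i" j] ij by (auto intro!: int_module.span_base simp: mult.assoc)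
    qed
  qed
  have y_stable: "y * v \<in> int_module.span S" if v: "v \<in> S" for v
  proof -
    obtain i j where ij: "i < d" "j < e" "v = x ^ i * y ^ j"
      using v by (auto simp: S_def)
    show ?thesis
    proof (cases "Suc j = e")
      case True
      then have "y * v = x ^ i * y ^ e" using ij by auto
      also have "\<dots> = (\<Sum>k<e. of_int (b k) * (x ^ i * y ^ k))"
        by (simp add: e(2) sum_distrib_left mult.left_commute)
      also have "\<dots> \<in> int_module.span S"
        using S ij by (intro int_module.span_sum int_module.span_scale int_module.span_base) auto
      finally show ?thesis .
    next
      case False
      then show ?thesis
        using S[of i "Suc j"] ij by (auto intro!: int_module.span_base simp: mult.left_commute)
    qed
  qed
  have extend: "a * v \<in> int_module.span S"
    if "\<And>v. v \<in> S \<Longrightarrow> a * v \<in> int_module.span S" "v \<in> int_module.span S" for a v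
    using that(2)
  proof (induction rule: int_module.span_induct_alt)
    case base
    then show ?case using int_module.span_zero by simp
  next
    case (step k u v)
    have "a * (of_int k * u + v) = of_int k * (a * u) + a * v" by (simp add: algebra_simps)
    then show ?case
      using step that(1) by (auto intro: int_module.span_add int_module.span_scale)
  qed
  show ?thesis
  proof (rule that[of S])
    show "finite S" by (simp add: S_def)
    show "\<exists>v\<in>S. v \<noteq> 0" using S[of 0 0] d e by (intro bexI[of _ 1]) auto
  qed (use extend x_stable y_stable in blast)+
qed

lemma algebraic_int_add:
  fixes x y :: "'a::field_char_0"
  assumes "algebraic_int x" "algebraic_int y"
  shows "algebraic_int (x + y)"
proof -
  obtain S where "finite S" "\<exists>v\<in>S. v \<noteq> 0"
    and "\<And>v. v \<in> int_module.span S \<Longrightarrow> x * v \<in> int_module.span S"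
    and "\<And>v. v \<in> int_module.span S \<Longrightarrow> y * v \<in> int_module.span S"
    using algebraic_int_common_stable_span[OF assms] by blast
  then show ?thesis
    by (intro algebraic_int_if_stable_span[of S])
       (auto simp: distrib_right intro: int_module.span_add int_module.span_base)
qed

lemma algebraic_int_mult:
  fixes x y :: "'a::field_char_0"
  assumes "algebraic_int x" "algebraic_int y"
  shows "algebraic_int (x * y)"
proof -
  obtain S where "finite S" "\<exists>v\<in>S. v \<noteq> 0"
    and "\<And>v. v \<in> int_module.span S \<Longrightarrow> x * v \<in> int_module.span S"
    and "\<And>v. v \<in> int_module.span S \<Longrightarrow> y * v \<in> int_module.span S"
    using algebraic_int_common_stable_span[OF assms] by blast
  then show ?thesis
    by (intro algebraic_int_if_stable_span[of S])
       (auto simp: mult.assoc intro: int_module.span_base)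
qed

lemma algebraic_int_diff:
  fixes x y :: "'a::field_char_0"
  assumes "algebraic_int x" "algebraic_int y"
  shows "algebraic_int (x - y)"
  using algebraic_int_add[of x "- y"] assms by simp

text \<open>If the span of \<open>S\<close> is stable under \<open>u\<close> and \<open>z\<close>,
  then that of \<open>S \<union> x S\<close> is stable under \<open>x\<close>, as
  \<open>x (x a) = x (u a) + z a\<close>. This is the instance of integral closedness needed for
  \<open>\<eta>\<close> and, with \<open>u = 0\<close>, for square roots of units.\<close>

lemma algebraic_int_quadratic:
  fixes x :: "'a::field_char_0"
  assumes u: "algebraic_int u" and z: "algebraic_int z" and x: "x\<^sup>2 = u * x + z"
  shows "algebraic_int x"
proof -
  obtain S where S: "finite S" "\<exists>v\<in>S. v \<noteq> 0"
    and Su: "\<And>v. v \<in> int_module.span S \<Longrightarrow> u * v \<in> int_module.span S"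
    and Sz: "\<And>v. v \<in> int_module.span S \<Longrightarrow> z * v \<in> int_module.span S"
    using algebraic_int_common_stable_span[OF u z] by blast
  define T where "T = S \<union> (*) x ` S"
  have ST: "v \<in> int_module.span T" if "v \<in> int_module.span S" for v
    using that int_module.span_mono[of S T] by (auto simp: T_def)
  have xST: "x * v \<in> int_module.span T" if "v \<in> int_module.span S" for v
    using that
  proof (induction rule: int_module.span_induct_alt)
    case base
    then show ?case using int_module.span_zero by simp
  next
    case (step k a v)
    have "x * (of_int k * a + v) = of_int k * (x * a) + x * v" by (simp add: algebra_simps)
    moreover have "x * a \<in> int_module.span T" using step by (auto simp: T_def intro: int_module.span_base)
    ultimately show ?case
      using step by (auto intro: int_module.span_add int_module.span_scale)
  qed
  show ?thesis
  proof (rule algebraic_int_if_stable_span)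
    show "finite T" "\<exists>v\<in>T. v \<noteq> 0" using S by (auto simp: T_def)
    fix v assume "v \<in> T"
    then consider "v \<in> S" | a where "a \<in> S" "v = x * a" by (auto simp: T_def)
    then show "x * v \<in> int_module.span T"
    proof cases
      case 1
      then show ?thesis by (intro xST int_module.span_base)
    next
      case 2
      have "x * v = x\<^sup>2 * a" by (simp add: 2(2) power2_eq_square)
      also have "\<dots> = x * (u * a) + z * a" unfolding x by (simp add: algebra_simps)
      finally have "x * v = x * (u * a) + z * a" .
      moreover have "a \<in> int_module.span S" using 2(1) by (rule int_module.span_base)
      ultimately show ?thesis by (simp only: int_module.span_add xST ST Su Sz)
    qed
  qed
qed

section \<open>Subfields and rational coordinates\<close>

lemma subfield_0: "is_subfield K \<Longrightarrow> 0 \<in> K"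
  and subfield_1: "is_subfield K \<Longrightarrow> 1 \<in> K"
  and subfield_add: "is_subfield K \<Longrightarrow> x \<in> K \<Longrightarrow> y \<in> K \<Longrightarrow> x + y \<in> K"
  and subfield_mult: "is_subfield K \<Longrightarrow> x \<in> K \<Longrightarrow> y \<in> K \<Longrightarrow> x * y \<in> K"
  and subfield_uminus: "is_subfield K \<Longrightarrow> x \<in> K \<Longrightarrow> - x \<in> K"
  and subfield_inverse: "is_subfield K \<Longrightarrow> x \<in> K \<Longrightarrow> inverse x \<in> K"
  by (auto simp: is_subfield_def)

lemma subfield_diff: "is_subfield K \<Longrightarrow> x \<in> K \<Longrightarrow> y \<in> K \<Longrightarrow> x - y \<in> K"
  using subfield_add[of K x "- y"] by (simp add: subfield_uminus)

lemma subfield_divide: "is_subfield K \<Longrightarrow> x \<in> K \<Longrightarrow> y \<in> K \<Longrightarrow> x / y \<in> K"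
  by (simp add: divide_inverse subfield_mult subfield_inverse)

lemma subfield_sum: "is_subfield K \<Longrightarrow> (\<And>i. i \<in> I \<Longrightarrow> f i \<in> K) \<Longrightarrow> (\<Sum>i\<in>I. f i) \<in> K"
  by (induction I rule: infinite_finite_induct) (auto simp: subfield_0 subfield_add)

lemma subfield_prod: "is_subfield K \<Longrightarrow> (\<And>i. i \<in> I \<Longrightarrow> f i \<in> K) \<Longrightarrow> (\<Prod>i\<in>I. f i) \<in> K"
  by (induction I rule: infinite_finite_induct) (auto simp: subfield_1 subfield_mult)

lemma subfield_power: "is_subfield K \<Longrightarrow> x \<in> K \<Longrightarrow> x ^ k \<in> K"
  by (induction k) (auto simp: subfield_1 subfield_mult)

lemma subfield_of_int: "is_subfield K \<Longrightarrow> of_int k \<in> K"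
proof -
  assume K: "is_subfield K"
  have "of_nat j \<in> K" for j by (induction j) (auto simp: K subfield_0 subfield_1 subfield_add)
  then show ?thesis
    by (cases k) (auto simp: K subfield_uminus simp del: of_nat_Suc)
qed

lemma subfield_of_rat: "is_subfield K \<Longrightarrow> of_rat q \<in> K"
  by (cases q) (auto simp: of_rat_rat subfield_divide subfield_of_int)

lemmas subfield_intros = subfield_0 subfield_1 subfield_add subfield_mult subfield_uminus
  subfield_diff subfield_inverse subfield_divide subfield_sum subfield_prod subfield_power
  subfield_of_int subfield_of_rat

section \<open>Coordinates with respect to a rational basis\<close>

definition lincomb_rat :: "nat \<Rightarrow> (nat \<Rightarrow> 'a::field_char_0) \<Rightarrow> (nat \<Rightarrow> rat) \<Rightarrow> 'a" where
  "lincomb_rat n b c = (\<Sum>i<n. of_rat (c i) * b i)"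

lemma lincomb_rat_add: "lincomb_rat n b (\<lambda>i. c i + d i) = lincomb_rat n b c + lincomb_rat n b d"
  unfolding lincomb_rat_def of_rat_add distrib_right sum.distrib ..

lemma lincomb_rat_scale: "lincomb_rat n b (\<lambda>i. q * c i) = of_rat q * lincomb_rat n b c"
  unfolding lincomb_rat_def of_rat_mult sum_distrib_left mult.assoc ..

lemma lincomb_rat_diff: "lincomb_rat n b (\<lambda>i. c i - d i) = lincomb_rat n b c - lincomb_rat n b d"
  unfolding lincomb_rat_def of_rat_diff left_diff_distrib sum_subtractf ..

text \<open>Bases are families indexed by numbers, so that coordinates can serve as matrix entries.
  Reusing \<open>free_module_on\<close> over \<open>\<rat>\<close> lets rational and integral bases
  of a quadratic extension come from the same lemma.\<close>

abbreviation rat_basis :: "'a::field_char_0 set \<Rightarrow> nat \<Rightarrow> (nat \<Rightarrow> 'a) \<Rightarrow> bool" where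
  "rat_basis K n b \<equiv> free_module_on \<rat> K {..<n} b"

lemma lincomb_Rats:
  assumes "\<forall>i\<in>{..<n}. c i \<in> \<rat>"
  obtains c' where "\<And>i. i < n \<Longrightarrow> c i = of_rat (c' i)" "(\<Sum>i<n. c i * b i) = lincomb_rat n b c'"
proof -
  have "\<exists>c'. \<forall>i\<in>{..<n}. c i = of_rat (c' i)"
    using assms by (intro bchoice) (auto elim: Rats_cases)
  then show ?thesis using that by (force simp: lincomb_rat_def)
qed

text \<open>Replaces coefficients in the subset \<open>\<rat>\<close> of the ambient field by
  coefficients of type \<open>rat\<close>, the type in which traces and determinants are
  computed.\<close>

lemma rat_basis_iff:
  "rat_basis K n b \<longleftrightarrow>
     K = range (lincomb_rat n b) \<and> (\<forall>c. lincomb_rat n b c = 0 \<longrightarrow> (\<forall>i<n. c i = 0))"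
proof -
  have 1: "{\<Sum>i\<in>{..<n}. c i * b i |c. \<forall>i\<in>{..<n}. c i \<in> \<rat>} = range (lincomb_rat n b)" (is "?A = ?B")
  proof
    show "?A \<subseteq> ?B" by (auto elim!: lincomb_Rats)
    show "?B \<subseteq> ?A"
    proof
      fix x assume "x \<in> ?B"
      then obtain c where "x = (\<Sum>i\<in>{..<n}. of_rat (c i) * b i)" by (auto simp: lincomb_rat_def)
      then show "x \<in> ?A" by (intro CollectI exI[of _ "\<lambda>i. of_rat (c i)"]) auto
    qed
  qed
  have 2: "(\<forall>c. (\<forall>i\<in>{..<n}. c i \<in> \<rat>) \<and> (\<Sum>i\<in>{..<n}. c i * b i) = 0 \<longrightarrow> (\<forall>i\<in>{..<n}. c i = 0)) \<longleftrightarrow>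
     (\<forall>c. lincomb_rat n b c = 0 \<longrightarrow> (\<forall>i<n. c i = 0))" (is "?P \<longleftrightarrow> ?Q")
  proof
    assume P: ?P
    show ?Q
    proof (intro allI impI)
      fix c i assume "lincomb_rat n b c = 0" "i < n"
      with P[rule_format, of "\<lambda>i. of_rat (c i)" i] show "c i = 0" by (simp add: lincomb_rat_def)
    qed
  next
    assume Q: ?Q
    show ?P
    proof (intro allI impI ballI, elim conjE)
      fix c i assume "\<forall>i\<in>{..<n}. c i \<in> \<rat>" and z: "(\<Sum>i\<in>{..<n}. c i * b i) = 0" and i: "i \<in> {..<n}"
      then obtain c' where "\<And>i. i < n \<Longrightarrow> c i = of_rat (c' i)" "(\<Sum>i<n. c i * b i) = lincomb_rat n b c'"
        using lincomb_Rats by blast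
      then show "c i = 0" using Q z i by simp
    qed
  qed
  show ?thesis unfolding free_module_on_def 1 2 ..
qed

text \<open>For \<open>x\<close> in the span of a basis, the values at indices below
  \<open>n\<close> are determined; the values at other indices are arbitrary.\<close>

definition coord :: "nat \<Rightarrow> (nat \<Rightarrow> 'a::field_char_0) \<Rightarrow> 'a \<Rightarrow> nat \<Rightarrow> rat" where
  "coord n b x = (SOME c. x = lincomb_rat n b c)"

lemma lincomb_coord: "rat_basis K n b \<Longrightarrow> x \<in> K \<Longrightarrow> lincomb_rat n b (coord n b x) = x"
proof -
  assume "rat_basis K n b" "x \<in> K"
  then have "\<exists>c. x = lincomb_rat n b c" by (auto simp: rat_basis_iff)
  from someI_ex[OF this] show ?thesis by (simp add: coord_def)
qed

lemma lincomb_mem: "rat_basis K n b \<Longrightarrow> lincomb_rat n b c \<in> K"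
  by (auto simp: rat_basis_iff)

lemma rat_basis_unique:
  assumes "rat_basis K n b" "lincomb_rat n b c = lincomb_rat n b d" "i < n"
  shows "c i = d i"
proof -
  have "lincomb_rat n b (\<lambda>i. c i - d i) = 0" using assms(2) by (simp add: lincomb_rat_diff)
  then show ?thesis using assms(1,3) by (fastforce simp: rat_basis_iff)
qed

lemma coord_lincomb: "rat_basis K n b \<Longrightarrow> i < n \<Longrightarrow> coord n b (lincomb_rat n b c) i = c i"
  by (rule rat_basis_unique) (auto simp: lincomb_coord lincomb_mem)

lemma coord_add:
  assumes "rat_basis K n b" "x \<in> K" "y \<in> K" "i < n"
  shows "coord n b (x + y) i = coord n b x i + coord n b y i"
  using coord_lincomb[OF assms(1,4), of "\<lambda>i. coord n b x i + coord n b y i"] assms(2,3)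
  unfolding lincomb_rat_add by (simp add: lincomb_coord[OF assms(1)])

lemma coord_scale:
  assumes "rat_basis K n b" "x \<in> K" "i < n"
  shows "coord n b (of_rat q * x) i = q * coord n b x i"
  using coord_lincomb[OF assms(1,3), of "\<lambda>i. q * coord n b x i"] assms(2)
  unfolding lincomb_rat_scale by (simp add: lincomb_coord[OF assms(1)])

lemma coord_0: "rat_basis K n b \<Longrightarrow> i < n \<Longrightarrow> coord n b 0 i = 0"
  using coord_lincomb[of K n b i "\<lambda>_. 0"] by (simp add: lincomb_rat_def)

lemma coord_sum:
  assumes K: "is_subfield K" "rat_basis K n b" "i < n" and "\<And>k. k \<in> I \<Longrightarrow> f k \<in> K"
  shows "coord n b (\<Sum>k\<in>I. of_rat (r k) * f k) i = (\<Sum>k\<in>I. r k * coord n b (f k) i)"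
  using assms(4)
proof (induction I rule: infinite_finite_induct)
  case (insert k I)
  then have "(\<Sum>k\<in>I. of_rat (r k) * f k) \<in> K" "of_rat (r k) * f k \<in> K"
    using K by (auto intro!: subfield_intros)
  then show ?case
    using insert K by (simp add: coord_add[OF K(2)] coord_scale[OF K(2)])
qed (use coord_0[OF K(2,3)] in auto)

lemma coord_basis: "rat_basis K n b \<Longrightarrow> i < n \<Longrightarrow> j < n \<Longrightarrow> coord n b (b j) i = (if i = j then 1 else 0)"
  using coord_lincomb[of K n b i "\<lambda>k. if k = j then 1 else 0"]
  by (simp add: lincomb_rat_def if_distrib[of of_rat] if_distrib[of "\<lambda>x. x * _"] cong: if_cong)

lemma basis_mem: "rat_basis K n b \<Longrightarrow> j < n \<Longrightarrow> b j \<in> K"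
  using lincomb_mem[of K n b "\<lambda>k. if k = j then 1 else 0"]
  by (simp add: lincomb_rat_def if_distrib[of of_rat] if_distrib[of "\<lambda>x. x * _"] cong: if_cong)

lemma rat_basis_inj: "rat_basis K n b \<Longrightarrow> inj_on b {..<n}"
  by (rule inj_onI) (metis coord_basis lessThan_iff zero_neq_one)

text \<open>Bridge from indexed bases to the set-based notions in which \<open>number_field\<close>,
  \<open>degree_of\<close> and \<open>field_trace\<close> are formulated.\<close>

lemma rat_basis_independent_span:
  assumes b: "rat_basis K n b"
  shows "rat_vec.independent (b ` {..<n})" "rat_vec.span (b ` {..<n}) = K"
proof -
  note inj = rat_basis_inj[OF b]
  have sum: "(\<Sum>v\<in>b ` {..<n}. of_rat (u v) * v) = lincomb_rat n b (u \<circ> b)" for u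
    by (simp add: sum.reindex[OF inj] lincomb_rat_def)
  show "rat_vec.independent (b ` {..<n})"
    using b by (auto simp: rat_vec.dependent_finite sum rat_basis_iff)
  show "rat_vec.span (b ` {..<n}) = K"
  proof
    show "rat_vec.span (b ` {..<n}) \<subseteq> K"
      using lincomb_mem[OF b] by (auto simp: rat_vec.span_finite sum)
    show "K \<subseteq> rat_vec.span (b ` {..<n})"
    proof
      fix x assume "x \<in> K"
      then have "x = (\<Sum>v\<in>b ` {..<n}. of_rat (coord n b x (the_inv_into {..<n} b v)) * v)"
        using lincomb_coord[OF b] inj
        by (simp add: sum.reindex[OF inj] lincomb_rat_def the_inv_into_f_f cong: sum.cong_simp)
      then show "x \<in> rat_vec.span (b ` {..<n})"
        by (auto simp: rat_vec.span_finite)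
    qed
  qed
qed

lemma degree_of_eq:
  assumes b: "rat_basis K n b"
  shows "degree_of K = n"
proof -
  have "rat_vec.dim K = card (b ` {..<n})"
    using rat_basis_independent_span[OF b] rat_vec.span_span[of "b ` {..<n}"]
    by (intro rat_vec.dim_eq_card) metis+
  then show ?thesis using rat_basis_inj[OF b] by (simp add: degree_of_def card_image)
qed

lemma number_field_iff: "number_field K \<longleftrightarrow> is_subfield K \<and> (\<exists>n b. rat_basis K n b)"
proof
  assume K: "number_field K"
  then obtain B where B: "finite B" "rat_vec.span B = K" by (auto simp: number_field_def)
  obtain B' where B': "B' \<subseteq> B" "rat_vec.independent B'" "B \<subseteq> rat_vec.span B'"
    using rat_vec.maximal_independent_subset[of B] by blast
  then have sp: "rat_vec.span B' = K"
    using B by (metis rat_vec.span_mono rat_vec.span_span subset_antisym)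
  have fin: "finite B'" using B B' by (auto intro: finite_subset)
  obtain f where f: "bij_betw f {0..<card B'} B'"
    using ex_bij_betw_nat_finite[OF fin] by blast
  define n where "n = card B'"
  have f: "inj_on f {..<n}" "f ` {..<n} = B'"
    using f by (auto simp: bij_betw_def n_def atLeast0LessThan)
  have sum: "(\<Sum>v\<in>B'. of_rat (u v) * v) = lincomb_rat n f (u \<circ> f)" for u
    using sum.reindex[OF f(1), of "\<lambda>v. of_rat (u v) * v"] f(2) by (simp add: lincomb_rat_def)
  have lin: "lincomb_rat n f c = (\<Sum>v\<in>B'. of_rat (c (the_inv_into {..<n} f v)) * v)" for c
    unfolding sum by (simp add: lincomb_rat_def the_inv_into_f_f f(1))
  have "rat_basis K n f"
    unfolding rat_basis_iff
  proof safe
    fix x assume "x \<in> K"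
    then show "x \<in> range (lincomb_rat n f)"
      unfolding sp[symmetric] rat_vec.span_finite[OF fin] sum by auto
  next
    fix c show "lincomb_rat n f c \<in> K"
      unfolding sp[symmetric] rat_vec.span_finite[OF fin] lin by auto
  next
    fix c i assume "lincomb_rat n f c = 0" "i < n"
    then have "\<forall>v\<in>B'. c (the_inv_into {..<n} f v) = 0"
      using B'(2) unfolding lin rat_vec.dependent_finite[OF fin] by metis
    then show "c i = 0" using \<open>i < n\<close> f by (metis image_eqI lessThan_iff the_inv_into_f_f)
  qed
  then show "is_subfield K \<and> (\<exists>n b. rat_basis K n b)" using K by (auto simp: number_field_def)
next
  assume "is_subfield K \<and> (\<exists>n b. rat_basis K n b)"
  then show "number_field K"
    unfolding number_field_def using rat_basis_independent_span(2) by blast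
qed


section \<open>The trace\<close>

text \<open>Changing from the basis chosen in \<open>field_trace\<close> to \<open>b\<close> is a change of the order of summation
  of the coordinates.\<close>

lemma field_trace_eq:
  assumes K: "is_subfield K" and b: "rat_basis K n b" and x: "x \<in> K"
  shows "field_trace K x = (\<Sum>i<n. coord n b (x * b i) i)"
proof -
  define B where "B = (SOME B. rat_vec.independent B \<and> rat_vec.span B = K)"
  have B: "rat_vec.independent B" "rat_vec.span B = K"
    using someI_ex[of "\<lambda>B. rat_vec.independent B \<and> rat_vec.span B = K"]
      rat_basis_independent_span[OF b] unfolding B_def by blast+
  have BK: "k \<in> K" if "k \<in> B" for k
    using that B(2) rat_vec.span_base by blast
  \<comment> \<open>\<open>B\<close> is an arbitrary choice, so its finiteness is inferred from the
    finite spanning set given by \<open>b\<close>.\<close>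
  have fin: "finite B"
    using rat_vec.independent_span_bound[OF _ B(1), of "b ` {..<n}"] rat_basis_independent_span(2)[OF b] BK
    by auto
  define R where "R = rat_vec.representation B"
  have R: "(\<Sum>k\<in>B. of_rat (R v k) * k) = v" if "v \<in> K" for v
    using rat_vec.sum_representation_eq[OF B(1) _ fin order_refl, of v] that B(2)
    by (simp add: R_def)
  have bK: "i < n \<Longrightarrow> x * b i \<in> K" for i
    using K x basis_mem[OF b] by (auto intro: subfield_mult)
  have "field_trace K x = (\<Sum>k\<in>B. R (x * k) k)"
    by (simp add: field_trace_def B_def[symmetric] Let_def R_def)
  also have "\<dots> = (\<Sum>k\<in>B. \<Sum>i<n. coord n b k i * R (x * b i) k)"
  proof (rule sum.cong)
    fix k assume k: "k \<in> B"
    have "x * k = x * lincomb_rat n b (coord n b k)"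
      using lincomb_coord[OF b BK[OF k]] by simp
    also have "\<dots> = (\<Sum>i<n. of_rat (coord n b k i) * (x * b i))"
      by (simp add: lincomb_rat_def sum_distrib_left mult.left_commute)
    also have "R \<dots> k = (\<Sum>i<n. R (of_rat (coord n b k i) * (x * b i)) k)"
      unfolding R_def using bK K B
      by (subst rat_vec.representation_sum) (auto intro: subfield_intros)
    also have "\<dots> = (\<Sum>i<n. coord n b k i * R (x * b i) k)"
      unfolding R_def using bK B
      by (intro sum.cong refl) (simp add: rat_vec.representation_scale)
    finally show "R (x * k) k = \<dots>" .
  qed simp
  also have "\<dots> = (\<Sum>i<n. \<Sum>k\<in>B. R (x * b i) k * coord n b k i)"
    by (subst sum.swap) (simp add: mult.commute)
  also have "\<dots> = (\<Sum>i<n. coord n b (x * b i) i)"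
  proof (rule sum.cong)
    fix i assume "i \<in> {..<n}"
    then show "(\<Sum>k\<in>B. R (x * b i) k * coord n b k i) = coord n b (x * b i) i"
      using R[OF bK] coord_sum[OF K b, of i B "\<lambda>k. k" "R (x * b i)"] BK by simp
  qed simp
  finally show ?thesis .
qed

lemma field_trace_add:
  assumes "number_field K" "x \<in> K" "y \<in> K"
  shows "field_trace K (x + y) = field_trace K x + field_trace K y"
proof -
  obtain n b where K: "is_subfield K" and b: "rat_basis K n b"
    using assms(1) by (auto simp: number_field_iff)
  have "coord n b ((x + y) * b i) i = coord n b (x * b i) i + coord n b (y * b i) i" if "i < n" for i
    using assms K basis_mem[OF b that] that
    by (simp add: distrib_right coord_add[OF b] subfield_intros)
  then show ?thesis
    using assms K by (simp add: field_trace_eq[OF K b] subfield_add sum.distrib)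
qed

lemma field_trace_scale:
  assumes "number_field K" "x \<in> K"
  shows "field_trace K (of_rat q * x) = q * field_trace K x"
proof -
  obtain n b where K: "is_subfield K" and b: "rat_basis K n b"
    using assms(1) by (auto simp: number_field_iff)
  have "coord n b (of_rat q * x * b i) i = q * coord n b (x * b i) i" if "i < n" for i
    using assms K basis_mem[OF b that] that
    by (simp add: mult.assoc coord_scale[OF b] subfield_intros)
  then show ?thesis
    using assms K by (simp add: field_trace_eq[OF K b] subfield_intros sum_distrib_left)
qed

lemma field_trace_0: "number_field K \<Longrightarrow> field_trace K 0 = 0"
  using field_trace_scale[of K 0 0] by (simp add: number_field_def is_subfield_def)

lemma field_trace_lincomb:
  assumes "number_field K" "\<And>i. i \<in> I \<Longrightarrow> f i \<in> K"
  shows "field_trace K (\<Sum>i\<in>I. of_rat (r i) * f i) = (\<Sum>i\<in>I. r i * field_trace K (f i))"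
  using assms(2)
proof (induction I rule: infinite_finite_induct)
  case (insert k I)
  then have "(\<Sum>k\<in>I. of_rat (r k) * f k) \<in> K" "of_rat (r k) * f k \<in> K"
    using assms(1) by (auto intro!: subfield_intros simp: number_field_def)
  then show ?case
    using insert assms(1) by (simp add: field_trace_add field_trace_scale)
qed (use field_trace_0[OF assms(1)] in auto)

text \<open>Being nonzero in characteristic 0, this value is what makes the trace form
  non-degenerate.\<close>

lemma field_trace_1:
  assumes "number_field K"
  shows "field_trace K 1 = of_nat (degree_of K)"
proof -
  obtain n b where K: "is_subfield K" and b: "rat_basis K n b"
    using assms(1) by (auto simp: number_field_iff)
  show ?thesis
    using degree_of_eq[OF b] by (simp add: field_trace_eq[OF K b] subfield_1 K coord_basis[OF b])
qed

lemma degree_pos: "number_field K \<Longrightarrow> degree_of K > 0"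
proof (rule ccontr)
  assume nf: "number_field K" and "\<not> degree_of K > 0"
  then obtain b where "rat_basis K 0 b" "is_subfield K"
    by (metis number_field_iff degree_of_eq gr0I)
  then have "1 \<in> range (lincomb_rat 0 b)" by (metis rat_basis_iff subfield_1)
  then show False by (auto simp: lincomb_rat_def)
qed

lemma number_field_rat_basis:
  assumes "number_field K"
  obtains b where "rat_basis K (degree_of K) b"
  using assms by (metis number_field_iff degree_of_eq)

section \<open>Rings of integers\<close>

lemma ring_of_integers_add: "is_subfield K \<Longrightarrow> x \<in> ring_of_integers K \<Longrightarrow> y \<in> ring_of_integers K \<Longrightarrow> x + y \<in> ring_of_integers K"
  and ring_of_integers_diff: "is_subfield K \<Longrightarrow> x \<in> ring_of_integers K \<Longrightarrow> y \<in> ring_of_integers K \<Longrightarrow> x - y \<in> ring_of_integers K"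
  and ring_of_integers_mult: "is_subfield K \<Longrightarrow> x \<in> ring_of_integers K \<Longrightarrow> y \<in> ring_of_integers K \<Longrightarrow> x * y \<in> ring_of_integers K"
  and ring_of_integers_of_int: "is_subfield K \<Longrightarrow> of_int k \<in> ring_of_integers K"
  and ring_of_integers_0: "is_subfield K \<Longrightarrow> 0 \<in> ring_of_integers K"
  and ring_of_integers_1: "is_subfield K \<Longrightarrow> 1 \<in> ring_of_integers K"
  by (auto simp: ring_of_integers_def algebraic_int_add algebraic_int_diff algebraic_int_mult
      intro: subfield_intros)

lemma ring_of_integers_sum:
  "is_subfield K \<Longrightarrow> (\<And>i. i \<in> I \<Longrightarrow> f i \<in> ring_of_integers K) \<Longrightarrow> (\<Sum>i\<in>I. f i) \<in> ring_of_integers K"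
  by (induction I rule: infinite_finite_induct) (auto simp: ring_of_integers_0 ring_of_integers_add)

lemma ring_of_integers_subset: "ring_of_integers K \<subseteq> K"
  by (auto simp: ring_of_integers_def)

lemma ring_of_integers_mono: "K \<subseteq> K' \<Longrightarrow> ring_of_integers K \<subseteq> ring_of_integers K'"
  by (auto simp: ring_of_integers_def)

lemma unit_group_mono: "R \<subseteq> R' \<Longrightarrow> unit_group R \<subseteq> unit_group R'"
  by (auto simp: unit_group_def)

section \<open>Clearing denominators\<close>

lemma of_int_multiple_eq_of_rat:
  fixes q :: rat
  assumes "snd (quotient_of q) dvd k"
  shows "of_int k * q = of_int (k div snd (quotient_of q) * fst (quotient_of q))"
proof -
  obtain a d where ad: "quotient_of q = (a, d)" by (cases "quotient_of q")
  obtain m where m: "k = d * m" using assms ad by (auto elim: dvdE)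
  have "d \<noteq> 0" "q = of_int a / of_int d"
    using quotient_of_denom_pos[OF ad] quotient_of_div[OF ad] by auto
  then have "of_int k * q = of_int (m * a)" by (simp add: m)
  then show ?thesis using \<open>d \<noteq> 0\<close> by (simp add: m ad)
qed

lemma common_denominator:
  fixes c :: "'i \<Rightarrow> rat"
  assumes "finite I"
  obtains k :: int and d where "k > 0" "\<And>i. i \<in> I \<Longrightarrow> of_int k * c i = of_int (d i)"
proof
  let ?k = "\<Prod>i\<in>I. snd (quotient_of (c i))"
  show "?k > 0" by (intro prod_pos) (simp add: quotient_of_denom_pos')
  fix i assume "i \<in> I"
  then show "of_int ?k * c i = of_int (?k div snd (quotient_of (c i)) * fst (quotient_of (c i)))"
    using assms by (intro of_int_multiple_eq_of_rat dvd_prodI)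
qed

text \<open>If \<open>k\<close> clears the denominators of the matrix of multiplication by
  \<open>x\<close>, then \<open>k x\<close> preserves the lattice spanned by the basis.\<close>

lemma integral_multiple:
  assumes K: "number_field K" and x: "x \<in> K"
  obtains k :: int where "k > 0" "of_int k * x \<in> ring_of_integers K"
proof -
  obtain b where b: "rat_basis K (degree_of K) b"
    using number_field_rat_basis[OF K] .
  define n where "n = degree_of K"
  note b = b[folded n_def]
  have sf: "is_subfield K" using K by (simp add: number_field_def)
  obtain k d where k: "k > 0"
    and d: "\<And>i. i \<in> {..<n} \<times> {..<n} \<Longrightarrow> of_int k * (case i of (i, j) \<Rightarrow> coord n b (x * b i) j) = of_int (d i)"
    using common_denominator[of "{..<n} \<times> {..<n}" "\<lambda>(i, j). coord n b (x * b i) j"] by blast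
  have "of_int k * x * b i \<in> int_module.span (b ` {..<n})" if i: "i < n" for i
  proof -
    have "of_int k * x * b i = of_rat (of_int k) * lincomb_rat n b (coord n b (x * b i))"
      using lincomb_coord[OF b, of "x * b i"] x basis_mem[OF b i] sf by (simp add: subfield_mult mult.assoc)
    also have "\<dots> = lincomb_rat n b (\<lambda>j. of_int k * coord n b (x * b i) j)"
      by (simp only: lincomb_rat_scale)
    also have "\<dots> = (\<Sum>j<n. of_int (d (i, j)) * b j)"
      unfolding lincomb_rat_def
    proof (rule sum.cong)
      fix j assume "j \<in> {..<n}"
      then have "of_int k * coord n b (x * b i) j = of_int (d (i, j))"
        using d[of "(i, j)"] i by simp
      then show "of_rat (of_int k * coord n b (x * b i) j) * b j = of_int (d (i, j)) * b j"
        by (simp only: of_rat_of_int_eq)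
    qed simp
    also have "\<dots> \<in> int_module.span (b ` {..<n})"
      by (intro int_module.span_sum int_module.span_scale int_module.span_base) auto
    finally show ?thesis .
  qed
  moreover have "\<exists>v\<in>b ` {..<n}. v \<noteq> 0"
    using degree_pos[OF K] coord_basis[OF b] coord_0[OF b] unfolding n_def[symmetric]
    by (intro bexI[of _ "b 0"]) fastforce+
  ultimately have "algebraic_int (of_int k * x)"
    by (intro algebraic_int_if_stable_span[of "b ` {..<n}"]) auto
  then show ?thesis
    using that[OF k] x sf by (auto simp: ring_of_integers_def intro!: subfield_intros)
qed


section \<open>Integrality of the trace\<close>

lemma trace_mult_commute:
  fixes A B :: "'a::comm_ring_1 mat"
  assumes "A \<in> carrier_mat n n" "B \<in> carrier_mat n n"
  shows "(\<Sum>i<n. (A * B) $$ (i, i)) = (\<Sum>i<n. (B * A) $$ (i, i))"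
proof -
  have tr: "(\<Sum>i<n. (A * B) $$ (i, i)) = (\<Sum>i<n. \<Sum>k<n. A $$ (i, k) * B $$ (k, i))"
    if "A \<in> carrier_mat n n" "B \<in> carrier_mat n n" for A B :: "'a mat"
    using that by (intro sum.cong) (auto simp: scalar_prod_def atLeast0LessThan)
  show ?thesis
    unfolding tr[OF assms] tr[OF assms(2,1)] by (subst sum.swap) (simp add: mult.commute)
qed

lemma trace_similar:
  fixes A B :: "'a::comm_ring_1 mat"
  assumes A: "A \<in> carrier_mat n n" and sim: "similar_mat A B"
  shows "(\<Sum>i<n. A $$ (i, i)) = (\<Sum>i<n. B $$ (i, i))"
proof -
  obtain P Q where "similar_mat_wit A B P Q" using sim by (auto simp: similar_mat_def)
  from similar_mat_witD2[OF A this]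
  have QP: "Q * P = 1\<^sub>m n" and AB: "A = P * B * Q"
    and c: "B \<in> carrier_mat n n" "P \<in> carrier_mat n n" "Q \<in> carrier_mat n n"
    by auto
  have "Q * (P * B) = B"
    using c QP by (simp flip: assoc_mult_mat[of Q n n P n B n])
  then show ?thesis
    using trace_mult_commute[of "P * B" n Q] c unfolding AB by simp
qed

lemma eigenvalue_upper_triangular_diag:
  fixes A B :: "'a::field mat"
  assumes A: "A \<in> carrier_mat n n" and sim: "similar_mat A B" and B: "upper_triangular B" and i: "i < n"
  shows "eigenvalue A (B $$ (i, i))"
proof -
  have Bc: "B \<in> carrier_mat n n"
    using sim A by (auto simp: similar_mat_def dest: similar_mat_witD2[OF A])
  have "char_poly A = (\<Prod>a\<leftarrow>diag_mat B. [:- a, 1:])"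
    using char_poly_similar[OF sim] char_poly_upper_triangular[OF Bc B] by simp
  moreover have "B $$ (i, i) \<in> set (diag_mat B)"
    using i Bc by (auto simp: diag_mat_def)
  ultimately have "poly (char_poly A) (B $$ (i, i)) = 0"
    by (auto simp: poly_prod_list prod_list_zero_iff)
  then show ?thesis using eigenvalue_root_char_poly[OF A] by simp
qed

text \<open>Over the complex numbers the characteristic polynomial splits, so \<open>A\<close> is
  similar to a triangular matrix; the trace is the sum of its diagonal entries, all of which are
  eigenvalues of \<open>A\<close>.\<close>

lemma algebraic_int_trace:
  fixes A :: "complex mat"
  assumes A: "A \<in> carrier_mat n n" and ev: "\<And>z. eigenvalue A z \<Longrightarrow> algebraic_int z"
  shows "algebraic_int (\<Sum>i<n. A $$ (i, i))"
proof -
  obtain es where "char_poly A = (\<Prod>a\<leftarrow>es. [:- a, 1:])"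
    using char_poly_factorized[OF A] by blast
  then obtain B where B: "upper_triangular B" "similar_mat A B"
    using schur_upper_triangular[OF A] by blast
  have sum: "algebraic_int (\<Sum>i\<in>I. f i)" if "\<And>i. i \<in> I \<Longrightarrow> algebraic_int (f i)"
    for I :: "nat set" and f :: "nat \<Rightarrow> complex"
    using that by (induction I rule: infinite_finite_induct) (auto intro: algebraic_int_add)
  show ?thesis
    unfolding trace_similar[OF A B(2)]
    using ev eigenvalue_upper_triangular_diag[OF A B(2,1)] by (intro sum) auto
qed

text \<open>A left eigenvector of the matrix of multiplication by \<open>x\<close> yields a rational linear functional
  \<open>\<phi>\<close> with \<open>\<phi> (x * y) = z * \<phi> y\<close>, so \<open>z\<close> is a root of every polynomial which annihilates \<open>x\<close>.\<close>

lemma eigenvalue_mult_matrix_algebraic_int: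
  fixes z :: complex
  assumes sf: "is_subfield K" and b: "rat_basis K n b" and x: "x \<in> ring_of_integers K"
    and ev: "eigenvalue (mat n n (\<lambda>(j, i). of_rat (coord n b (x * b j) i))) z"
  shows "algebraic_int z"
proof -
  have xK: "x \<in> K" and xint: "algebraic_int x" using x by (auto simp: ring_of_integers_def)
  obtain v where v: "v \<in> carrier_vec n" "v \<noteq> 0\<^sub>v n"
    and Av: "mat n n (\<lambda>(j, i). of_rat (coord n b (x * b j) i)) *\<^sub>v v = z \<cdot>\<^sub>v v"
    using ev by (auto simp: eigenvalue_def eigenvector_def)
  \<comment> \<open>The linear extension of \<open>b j \<mapsto> v $ j\<close>. Row \<open>j\<close>
    of the matrix holds the coordinates of \<open>x * b j\<close>, so the eigenvector equation reads
    \<open>\<phi> (x * b j) = z * \<phi> (b j)\<close>.\<close>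
  define \<phi> where "\<phi> y = (\<Sum>i<n. of_rat (coord n b y i) * v $ i)" for y
  have phi_b: "\<phi> (b j) = v $ j" if "j < n" for j
    using that by (simp add: \<phi>_def coord_basis[OF b] if_distrib[of of_rat] if_distrib[of "\<lambda>x. x * _"] cong: if_cong)
  have phi_lin: "\<phi> (\<Sum>k\<in>I. of_rat (r k) * f k) = (\<Sum>k\<in>I. of_rat (r k) * \<phi> (f k))"
    if "\<And>k. k \<in> I \<Longrightarrow> f k \<in> K" for r f and I :: "nat set"
  proof -
    have "\<phi> (\<Sum>k\<in>I. of_rat (r k) * f k) = (\<Sum>i<n. \<Sum>k\<in>I. of_rat (r k) * (of_rat (coord n b (f k) i) * v $ i))"
      unfolding \<phi>_def
    proof (rule sum.cong)
      fix i assume "i \<in> {..<n}"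
      then have "coord n b (\<Sum>k\<in>I. of_rat (r k) * f k) i = (\<Sum>k\<in>I. r k * coord n b (f k) i)"
        using that by (intro coord_sum[OF sf b]) auto
      then show "of_rat (coord n b (\<Sum>k\<in>I. of_rat (r k) * f k) i) * v $ i =
          (\<Sum>k\<in>I. of_rat (r k) * (of_rat (coord n b (f k) i) * v $ i))"
        by (simp only: of_rat_sum of_rat_mult sum_distrib_right mult.assoc)
    qed simp
    then show ?thesis
      by (subst (asm) sum.swap) (simp add: \<phi>_def sum_distrib_left)
  qed
  have phi_xb: "\<phi> (x * b j) = z * \<phi> (b j)" if j: "j < n" for j
    using arg_cong[OF Av, of "\<lambda>w. w $ j"] j v(1)
    by (simp add: phi_b) (simp add: \<phi>_def scalar_prod_def atLeast0LessThan)
  have phi_x: "\<phi> (x * y) = z * \<phi> y" if y: "y \<in> K" for y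
  proof -
    have y_eq: "y = (\<Sum>j<n. of_rat (coord n b y j) * b j)"
      using lincomb_coord[OF b y] by (simp add: lincomb_rat_def)
    have "\<phi> (x * y) = \<phi> (\<Sum>j<n. of_rat (coord n b y j) * (x * b j))"
      by (subst y_eq) (simp add: sum_distrib_left mult.left_commute)
    also have "\<dots> = (\<Sum>j<n. of_rat (coord n b y j) * (z * \<phi> (b j)))"
      using basis_mem[OF b] xK sf by (subst phi_lin) (auto simp: phi_xb intro: subfield_mult)
    also have "\<dots> = z * \<phi> y"
      using phi_lin[of "{..<n}" b "coord n b y"] basis_mem[OF b] y_eq
      by (simp add: sum_distrib_left mult.left_commute)
    finally show ?thesis .
  qed
  have phi_pow: "\<phi> (x ^ k * y) = z ^ k * \<phi> y" if "y \<in> K" for k y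
    using that phi_x xK sf by (induction k) (simp_all add: mult.assoc subfield_intros)
  obtain p where p: "poly (map_poly of_int p) x = 0" "lead_coeff p = 1"
    using xint unfolding algebraic_int_altdef_ipoly by blast
  obtain j where j: "j < n" "v $ j \<noteq> 0"
    using v by (metis carrier_vecD eq_vecI index_zero_vec)
  have "(\<Sum>k\<le>degree p. of_int (coeff p k) * x ^ k) = 0"
    using p(1) by (simp add: poly_altdef coeff_map_poly)
  \<comment> \<open>The relation \<open>p(x) = 0\<close> times \<open>b j\<close>, where
    \<open>\<phi> (b j) = v $ j\<close> is nonzero: applying \<open>\<phi>\<close> turns powers of
    \<open>x\<close> into powers of \<open>z\<close>. The coefficients are written as rationals to
    fit \<open>phi_lin\<close>.\<close>
  then have "(\<Sum>k\<le>degree p. of_rat (of_int (coeff p k)) * (x ^ k * b j)) = 0"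
    by (simp flip: sum_distrib_right mult.assoc)
  then have "0 = \<phi> (\<Sum>k\<le>degree p. of_rat (of_int (coeff p k)) * (x ^ k * b j))"
    by (simp add: \<phi>_def coord_0[OF b])
  also have "\<dots> = (\<Sum>k\<le>degree p. of_rat (of_int (coeff p k)) * \<phi> (x ^ k * b j))"
    using basis_mem[OF b j(1)] xK sf by (intro phi_lin) (auto intro!: subfield_intros)
  also have "\<dots> = (\<Sum>k\<le>degree p. of_int (coeff p k) * z ^ k) * v $ j"
    using basis_mem[OF b j(1)] j(1) by (simp add: phi_pow phi_b sum_distrib_right mult.assoc)
  finally have "poly (map_poly of_int p) z = 0"
    using j(2) by (simp add: poly_altdef coeff_map_poly)
  then show ?thesis
    unfolding algebraic_int_altdef_ipoly using p(2) by blast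
qed

text \<open>The trace is rational, and as an algebraic integer it is therefore an integer. The
  matrix is moved to the complex numbers, where it can be triangularised.\<close>

lemma field_trace_integer:
  assumes K: "number_field K" and x: "x \<in> ring_of_integers K"
  shows "field_trace K x \<in> \<int>"
proof -
  obtain b where b: "rat_basis K (degree_of K) b"
    using number_field_rat_basis[OF K] .
  define n where "n = degree_of K"
  note b = b[folded n_def]
  have sf: "is_subfield K" using K by (simp add: number_field_def)
  define A :: "complex mat" where "A = mat n n (\<lambda>(j, i). of_rat (coord n b (x * b j) i))"
  have "of_rat (field_trace K x) = (\<Sum>i<n. A $$ (i, i))"
    using field_trace_eq[OF sf b] x by (simp add: A_def of_rat_sum ring_of_integers_def)
  moreover have "algebraic_int (\<Sum>i<n. A $$ (i, i))"
    by (rule algebraic_int_trace) (use eigenvalue_mult_matrix_algebraic_int[OF sf b x] in \<open>auto simp: A_def\<close>)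
  ultimately have "of_rat (field_trace K x) \<in> (\<int> :: complex set)"
    by (metis rational_algebraic_int_is_int Rats_of_rat)
  then obtain k where "of_rat (field_trace K x) = (of_rat (of_int k) :: complex)"
    by (auto elim: Ints_cases)
  then show ?thesis unfolding of_rat_eq_iff by simp
qed

section \<open>Discriminants and integral bases\<close>

text \<open>The discriminant of the tuple \<open>b 0, ..., b (n - 1)\<close> under the trace
  form.\<close>

definition gram_det :: "'a::field_char_0 set \<Rightarrow> nat \<Rightarrow> (nat \<Rightarrow> 'a) \<Rightarrow> rat" where
  "gram_det K n b = det (mat n n (\<lambda>(i, j). field_trace K (b i * b j)))"

text \<open>With \<open>M\<close> the matrix of \<open>P\<close>, the Gram matrices satisfy
  \<open>G' = M * G * M\<^sup>T\<close>.\<close>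

lemma gram_det_change_basis:
  assumes K: "number_field K" and b: "\<And>i. i < n \<Longrightarrow> b i \<in> K"
    and b': "\<And>i. i < n \<Longrightarrow> b' i = lincomb_rat n b (P i)"
  shows "gram_det K n b' = (det (mat n n (\<lambda>(i, j). P i j)))\<^sup>2 * gram_det K n b"
proof -
  have sf: "is_subfield K" using K by (simp add: number_field_def)
  define M where "M = mat n n (\<lambda>(i, j). P i j)"
  define G where "G = mat n n (\<lambda>(i, j). field_trace K (b i * b j))"
  have b'K: "b' i \<in> K" if "i < n" for i
    unfolding b'[OF that] lincomb_rat_def using b by (intro subfield_sum subfield_mult subfield_of_rat sf) auto
  have tr: "field_trace K (b' i * x) = (\<Sum>k<n. P i k * field_trace K (b k * x))" if "i < n" "x \<in> K" for i x
  proof -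
    have "b' i * x = (\<Sum>k<n. of_rat (P i k) * (b k * x))"
      unfolding b'[OF that(1)] lincomb_rat_def by (simp add: sum_distrib_right mult.assoc)
    then show ?thesis
      using field_trace_lincomb[OF K, of "{..<n}" "\<lambda>k. b k * x" "P i"] b that(2) sf
      by (simp add: subfield_mult)
  qed
  have "mat n n (\<lambda>(i, j). field_trace K (b' i * b' j)) = M * (G * M\<^sup>T)" (is "?G' = _")
  proof (rule eq_matI)
    fix i j assume ij: "i < dim_row (M * (G * M\<^sup>T))" "j < dim_col (M * (G * M\<^sup>T))"
    then have ij: "i < n" "j < n" by (auto simp: M_def)
    have GM: "(G * M\<^sup>T) $$ (k, j) = field_trace K (b k * b' j)" if "k < n" for k
      using that ij b tr[OF ij(2), of "b k"]
      by (simp add: G_def M_def scalar_prod_def atLeast0LessThan mult.commute)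
    have "(M * (G * M\<^sup>T)) $$ (i, j) = (\<Sum>k<n. P i k * (G * M\<^sup>T) $$ (k, j))"
    proof -
      define H where "H = G * M\<^sup>T"
      have "H \<in> carrier_mat n n"
        unfolding H_def by (rule mult_carrier_mat[of _ n n]) (auto simp: G_def M_def)
      then show ?thesis
        unfolding H_def[symmetric] using ij by (simp add: M_def scalar_prod_def atLeast0LessThan)
    qed
    also have "\<dots> = field_trace K (b' i * b' j)"
      using GM tr[OF ij(1) b'K[OF ij(2)]] by simp
    finally show "?G' $$ (i, j) = (M * (G * M\<^sup>T)) $$ (i, j)"
      using ij by simp
  qed (auto simp: M_def)
  moreover have "M \<in> carrier_mat n n" "G \<in> carrier_mat n n" by (auto simp: M_def G_def)
  ultimately show ?thesis
    unfolding gram_det_def M_def[symmetric] G_def[symmetric]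
    by (simp add: det_mult[of _ n] det_transpose[of _ n] power2_eq_square)
qed

text \<open>A kernel vector of the Gram matrix gives a nonzero \<open>x\<close> orthogonal to all of
  \<open>K\<close>, in particular to \<open>inverse x\<close>; but the trace of 1 is the
  degree.\<close>

lemma gram_det_nonzero:
  assumes K: "number_field K" and b: "rat_basis K n b"
  shows "gram_det K n b \<noteq> 0"
proof
  have sf: "is_subfield K" using K by (simp add: number_field_def)
  define G where "G = mat n n (\<lambda>(i, j). field_trace K (b i * b j))"
  assume "gram_det K n b = 0"
  then have "det G = 0" by (simp add: gram_det_def G_def)
  moreover have "G \<in> carrier_mat n n" by (simp add: G_def)
  ultimately obtain v where v: "v \<in> carrier_vec n" "v \<noteq> 0\<^sub>v n" "G *\<^sub>v v = 0\<^sub>v n"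
    using det_0_iff_vec_prod_zero by blast
  define x where "x = lincomb_rat n b (\<lambda>i. v $ i)"
  have xK: "x \<in> K" unfolding x_def by (rule lincomb_mem[OF b])
  have "x \<noteq> 0"
  proof
    assume "x = 0"
    then have "\<forall>i<n. v $ i = 0" using b unfolding x_def rat_basis_iff by blast
    then show False using v(1,2) by (metis carrier_vecD eq_vecI index_zero_vec)
  qed
  have tr_b: "field_trace K (b i * x) = 0" if i: "i < n" for i
  proof -
    have "field_trace K (b i * x) = field_trace K (\<Sum>j<n. of_rat (v $ j) * (b i * b j))"
      by (simp add: x_def lincomb_rat_def sum_distrib_left mult.left_commute)
    also have "\<dots> = (\<Sum>j<n. v $ j * field_trace K (b i * b j))"
      using basis_mem[OF b] i sf by (intro field_trace_lincomb[OF K]) (auto intro: subfield_mult)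
    also have "\<dots> = (G *\<^sub>v v) $ i"
      using i v(1) by (simp add: G_def scalar_prod_def atLeast0LessThan mult.commute)
    finally show ?thesis using v(3) i by simp
  qed
  have "1 = lincomb_rat n b (coord n b (inverse x)) * x"
    using lincomb_coord[OF b subfield_inverse[OF sf xK]] \<open>x \<noteq> 0\<close> by simp
  also have "\<dots> = (\<Sum>i<n. of_rat (coord n b (inverse x) i) * (b i * x))"
    by (simp add: lincomb_rat_def sum_distrib_right mult.assoc)
  finally have "field_trace K 1 = (\<Sum>i<n. coord n b (inverse x) i * field_trace K (b i * x))"
    using field_trace_lincomb[OF K, of "{..<n}" "\<lambda>i. b i * x" "coord n b (inverse x)"]
      basis_mem[OF b] xK sf by (simp add: subfield_mult)
  then show False
    using tr_b field_trace_1[OF K] degree_pos[OF K] by simp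
qed

lemma det_integer:
  assumes "\<And>i j. i < n \<Longrightarrow> j < n \<Longrightarrow> f i j \<in> \<int>"
  shows "det (mat n n (\<lambda>(i, j). f i j)) \<in> (\<int> :: 'a::comm_ring_1 set)"
proof -
  define g where "g i j = (SOME k. f i j = of_int k)" for i j
  have "f i j = of_int (g i j)" if "i < n" "j < n" for i j
    unfolding g_def using assms[OF that] by (intro someI_ex[of "\<lambda>k. f i j = of_int k"]) (auto elim: Ints_cases)
  then have "mat n n (\<lambda>(i, j). f i j) = map_mat of_int (mat n n (\<lambda>(i, j). g i j))"
    by (intro eq_matI) auto
  then show ?thesis by (simp add: of_int_hom.hom_det)
qed

lemma gram_det_integer:
  assumes "number_field K" "\<And>i. i < n \<Longrightarrow> b i \<in> ring_of_integers K"
  shows "gram_det K n b \<in> \<int>"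
  unfolding gram_det_def using assms
  by (intro det_integer field_trace_integer ring_of_integers_mult) (auto simp: number_field_def)

text \<open>Coordinates transform by the transpose \<open>M\<close>: the combination of
  \<open>b'\<close> with coefficients \<open>c\<close> is the combination of \<open>b\<close> with
  coefficients \<open>M c\<close>. Invertibility of \<open>M\<close> gives spanning and
  independence.\<close>

lemma rat_basis_change:
  assumes b: "rat_basis K n b" and b': "\<And>i. i < n \<Longrightarrow> b' i = lincomb_rat n b (P i)"
    and P: "det (mat n n (\<lambda>(i, j). P i j)) \<noteq> 0"
  shows "rat_basis K n b'"
proof -
  define M where "M = (mat n n (\<lambda>(i, j). P i j))\<^sup>T"
  have M: "M \<in> carrier_mat n n" by (simp add: M_def)
  have detM: "det M \<noteq> 0" using P unfolding M_def by (subst det_transpose) auto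
  have comb: "lincomb_rat n b' c = lincomb_rat n b (\<lambda>j. (M *\<^sub>v vec n c) $ j)" for c
  proof -
    have "lincomb_rat n b' c = (\<Sum>i<n. \<Sum>j<n. of_rat (c i * P i j) * b j)"
      unfolding lincomb_rat_def[of n b']
    proof (rule sum.cong)
      fix i assume "i \<in> {..<n}"
      then have "b' i = (\<Sum>j<n. of_rat (P i j) * b j)" using b' by (simp add: lincomb_rat_def)
      then show "of_rat (c i) * b' i = (\<Sum>j<n. of_rat (c i * P i j) * b j)"
        by (simp only: sum_distrib_left of_rat_mult mult.assoc)
    qed simp
    also have "\<dots> = (\<Sum>j<n. of_rat (\<Sum>i<n. c i * P i j) * b j)"
      by (subst sum.swap) (simp add: of_rat_sum sum_distrib_right)
    also have "\<dots> = lincomb_rat n b (\<lambda>j. (M *\<^sub>v vec n c) $ j)"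
      unfolding lincomb_rat_def
      by (intro sum.cong refl) (simp add: M_def scalar_prod_def atLeast0LessThan mult.commute)
    finally show ?thesis .
  qed
  obtain N where N: "N \<in> carrier_mat n n" "M * N = 1\<^sub>m n"
    using det_non_zero_imp_unit[OF M detM, unfolded Units_def, of "()"] by (auto simp: ring_mat_def)
  show ?thesis
    unfolding rat_basis_iff
  proof safe
    fix x assume x: "x \<in> K"
    define y where "y = N *\<^sub>v vec n (coord n b x)"
    have "M *\<^sub>v y = vec n (coord n b x)"
      using M N by (simp add: y_def assoc_mult_mat_vec[symmetric, of M n n N n])
    moreover have "vec n (\<lambda>i. y $ i) = y" using N by (auto simp: y_def)
    ultimately have "lincomb_rat n b' (\<lambda>i. y $ i) = lincomb_rat n b (\<lambda>j. vec n (coord n b x) $ j)"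
      by (simp add: comb)
    also have "\<dots> = x" using lincomb_coord[OF b x] by (simp add: lincomb_rat_def)
    finally show "x \<in> range (lincomb_rat n b')" by (metis rangeI)
  next
    fix c show "lincomb_rat n b' c \<in> K" unfolding comb by (rule lincomb_mem[OF b])
  next
    fix c i assume "lincomb_rat n b' c = 0" and i: "i < n"
    then have "\<forall>j<n. (M *\<^sub>v vec n c) $ j = 0"
      using b unfolding comb rat_basis_iff by blast
    then have "M *\<^sub>v vec n c = 0\<^sub>v n" using M by (intro eq_vecI) auto
    then have "vec n c = 0\<^sub>v n"
      using det_0_iff_vec_prod_zero[OF M] detM by (metis vec_carrier)
    then show "c i = 0" using i by (metis index_vec index_zero_vec(1))
  qed
qed

section \<open>Integral bases and the discriminant\<close>

lemma free_module_on_mem: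
  assumes "free_module_on R M I e" "finite I" "i \<in> I" "0 \<in> R" "1 \<in> R"
  shows "e i \<in> M"
proof -
  have "(\<Sum>j\<in>I. (if j = i then 1 else 0) * e j) = e i"
    using assms by (simp add: if_distrib[of "\<lambda>x. x * _"] cong: if_cong)
  then have "e i = (\<Sum>j\<in>I. (if j = i then 1 else 0) * e j)" ..
  then have "e i \<in> {\<Sum>i\<in>I. c i * e i | c. \<forall>i\<in>I. c i \<in> R}"
    using assms(4,5) by (intro CollectI exI[of _ "\<lambda>j. if j = i then 1 else 0"]) auto
  then show ?thesis using assms(1) by (simp add: free_module_on_def)
qed

lemma int_basis_coords:
  assumes "free_module_on \<int> M {..<n} b" "x \<in> M"
  shows "\<exists>c. x = (\<Sum>i<n. of_int (c i) * b i)"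
proof -
  obtain c where c: "x = (\<Sum>i<n. c i * b i)" "\<forall>i\<in>{..<n}. c i \<in> \<int>"
    using assms by (auto simp: free_module_on_def)
  have "\<exists>c'. \<forall>i\<in>{..<n}. c i = of_int (c' i)"
    using c(2) by (intro bchoice) (auto elim: Ints_cases)
  then obtain c' where "\<forall>i\<in>{..<n}. c i = of_int (c' i)" by blast
  then show ?thesis using c(1) by auto
qed

lemma int_basis_unique:
  fixes b :: "nat \<Rightarrow> 'a::{comm_ring_1, ring_char_0}"
  assumes "free_module_on \<int> M {..<n} b" "(\<Sum>i<n. of_int (c i) * b i) = (\<Sum>i<n. of_int (d i) * b i)" "i < n"
  shows "c i = d i"
proof -
  have "(\<Sum>i<n. of_int (c i - d i) * b i) = 0"
    using assms(2) by (simp add: left_diff_distrib sum_subtractf)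
  moreover have "\<And>c. (\<forall>i\<in>{..<n}. c i \<in> \<int>) \<Longrightarrow> (\<Sum>i<n. c i * b i) = 0 \<Longrightarrow> \<forall>i\<in>{..<n}. c i = 0"
    using assms(1) unfolding free_module_on_def by blast
  from this[of "\<lambda>i. of_int (c i - d i)"]
  have "(\<Sum>i<n. of_int (c i - d i) * b i) = 0 \<Longrightarrow> of_int (c i - d i) = (0 :: 'a)"
    using assms(3) by simp
  ultimately have "of_int (c i - d i) = (0 :: 'a)" by blast
  then show ?thesis by (simp only: of_int_eq_0_iff right_minus_eq)
qed

text \<open>Uniqueness of coordinates with respect to \<open>b\<close> forces \<open>Q * P\<close>
  to be the identity, so the determinant of \<open>P\<close> is a unit of the integers.\<close>

lemma int_basis_change_det:
  fixes b :: "nat \<Rightarrow> 'a::{comm_ring_1, ring_char_0}"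
  assumes b: "free_module_on \<int> M {..<n} b"
    and P: "\<And>i. i < n \<Longrightarrow> b' i = (\<Sum>j<n. of_int (P i j) * b j)"
    and Q: "\<And>i. i < n \<Longrightarrow> b i = (\<Sum>j<n. of_int (Q i j) * b' j)"
  shows "\<bar>det (mat n n (\<lambda>(i, j). P i j))\<bar> = (1::int)"
proof -
  let ?P = "mat n n (\<lambda>(i, j). P i j)" and ?Q = "mat n n (\<lambda>(i, j). Q i j)"
  have "?Q * ?P = 1\<^sub>m n"
  proof (rule eq_matI)
    fix i k assume "i < dim_row (1\<^sub>m n :: int mat)" "k < dim_col (1\<^sub>m n :: int mat)"
    then have ik: "i < n" "k < n" by auto
    have "(\<Sum>k<n. of_int (\<Sum>j<n. Q i j * P j k) * b k) = (\<Sum>j<n. of_int (Q i j) * (\<Sum>k<n. of_int (P j k) * b k))"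
      unfolding of_int_sum of_int_mult sum_distrib_left sum_distrib_right mult.assoc by (rule sum.swap)
    also have "\<dots> = (\<Sum>j<n. of_int (Q i j) * b' j)"
      using P by simp
    also have "\<dots> = b i" using Q ik by simp
    also have "\<dots> = (\<Sum>k<n. of_int (if k = i then 1 else 0) * b k)"
      using ik by (simp add: if_distrib[of of_int] if_distrib[of "\<lambda>x. x * _"] cong: if_cong)
    finally have "(\<Sum>j<n. Q i j * P j k) = (if k = i then 1 else 0)"
      using int_basis_unique[OF b _ ik(2), of "\<lambda>k. \<Sum>j<n. Q i j * P j k" "\<lambda>k. if k = i then 1 else 0"] by simp
    then show "(?Q * ?P) $$ (i, k) = 1\<^sub>m n $$ (i, k)"
      using ik by (auto simp: scalar_prod_def atLeast0LessThan)
  qed auto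
  then have "det ?Q * det ?P = 1"
    by (subst det_mult[symmetric, of _ n]) auto
  then show ?thesis by (metis abs_mult abs_one abs_zmult_eq_1 mult.commute)
qed

text \<open>Spanning holds because each element of \<open>K\<close> has a positive multiple that is
  integral; independence, because a rational relation becomes an integer relation after clearing
  denominators.\<close>

lemma integral_basis_rat_basis:
  assumes K: "number_field K" and b: "free_module_on \<int> (ring_of_integers K) {..<n} b"
  shows "rat_basis K n b"
  unfolding rat_basis_iff
proof safe
  fix x assume x: "x \<in> K"
  obtain k where k: "k > 0" "of_int k * x \<in> ring_of_integers K"
    using integral_multiple[OF K x] .
  obtain c where c: "of_int k * x = (\<Sum>i<n. of_int (c i) * b i)"
    using int_basis_coords[OF b k(2)] by blast
  have "x = (of_int k * x) / of_int k" using k(1) by simp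
  also have "\<dots> = lincomb_rat n b (\<lambda>i. of_int (c i) / of_int k)"
    unfolding c lincomb_rat_def by (simp add: sum_divide_distrib of_rat_divide)
  finally show "x \<in> range (lincomb_rat n b)" by blast
next
  have sf: "is_subfield K" using K by (simp add: number_field_def)
  fix c
  have "b i \<in> K" if "i < n" for i
    using free_module_on_mem[OF b, of i] that ring_of_integers_subset by auto
  then show "lincomb_rat n b c \<in> K"
    unfolding lincomb_rat_def using sf by (intro subfield_sum subfield_mult subfield_of_rat) auto
next
  fix c i assume z: "lincomb_rat n b c = 0" and i: "i < n"
  obtain k d where k: "k > 0" and d: "\<And>i. i \<in> {..<n} \<Longrightarrow> of_int k * c i = of_int (d i)"
    using common_denominator[of "{..<n}" c] by blast
  have "(\<Sum>i<n. of_int (d i) * b i) = lincomb_rat n b (\<lambda>i. of_int k * c i)"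
    unfolding lincomb_rat_def using d by simp
  also have "\<dots> = 0" by (simp only: lincomb_rat_scale z mult_zero_right)
  finally have "d i = 0"
    by (intro int_basis_unique[OF b _ i, of d "\<lambda>_. 0"]) simp
  then show "c i = 0" using d[of i] i k by simp
qed

text \<open>Frees the discriminant from the choice in its definition: two integral bases differ by a
  matrix of determinant 1 or -1, which enters the Gram determinant squared.\<close>

lemma discriminant_eq:
  assumes K: "number_field K" and b: "integral_basis K b"
  shows "discriminant K = gram_det K (degree_of K) b"
proof -
  define n where "n = degree_of K"
  define b' where "b' = (SOME b. integral_basis K b)"
  have b': "integral_basis K b'" unfolding b'_def by (rule someI[of _ b]) (rule b)
  note B = b[unfolded integral_basis_def n_def[symmetric]] and B' = b'[unfolded integral_basis_def n_def[symmetric]]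
  have mem: "b i \<in> ring_of_integers K" "b' i \<in> ring_of_integers K" if "i < n" for i
    using free_module_on_mem[OF B, of i] free_module_on_mem[OF B', of i] that by auto
  have "\<exists>P. \<forall>i\<in>{..<n}. b' i = (\<Sum>j<n. of_int (P i j) * b j)"
    by (intro bchoice ballI int_basis_coords[OF B] mem(2)) simp
  then obtain P where P: "\<And>i. i < n \<Longrightarrow> b' i = (\<Sum>j<n. of_int (P i j) * b j)" by blast
  have "\<exists>Q. \<forall>i\<in>{..<n}. b i = (\<Sum>j<n. of_int (Q i j) * b' j)"
    by (intro bchoice ballI int_basis_coords[OF B'] mem(1)) simp
  then obtain Q where Q: "\<And>i. i < n \<Longrightarrow> b i = (\<Sum>j<n. of_int (Q i j) * b' j)" by blast
  have "(det (mat n n (\<lambda>(i, j). P i j)))\<^sup>2 = 1"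
    using int_basis_change_det[OF B P Q] by (simp add: abs_square_eq_1)
  moreover have "mat n n (\<lambda>(i, j). of_int (P i j)) = map_mat rat_of_int (mat n n (\<lambda>(i, j). P i j))"
    by (intro eq_matI) auto
  ultimately have "(det (mat n n (\<lambda>(i, j). rat_of_int (P i j))))\<^sup>2 = 1"
    by (simp add: of_int_hom.hom_det flip: of_int_power)
  moreover have "gram_det K n b' = (det (mat n n (\<lambda>(i, j). rat_of_int (P i j))))\<^sup>2 * gram_det K n b"
    using mem ring_of_integers_subset P by (intro gram_det_change_basis[OF K]) (auto simp: lincomb_rat_def)
  ultimately show ?thesis
    by (simp add: discriminant_def b'_def[symmetric] gram_det_def n_def Let_def)
qed

text \<open>Cramer's rule for the identity matrix, transposed.\<close>

lemma det_replace_row_one: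
  fixes c :: "nat \<Rightarrow> 'a::field"
  assumes k: "k < n"
  shows "det (mat n n (\<lambda>(i, j). if i = k then c j else if i = j then 1 else 0)) = c k" (is "det ?M = _")
proof -
  have "?M\<^sup>T = replace_col (1\<^sub>m n) (1\<^sub>m n *\<^sub>v vec n c) k"
    by (rule eq_matI) (auto simp: replace_col_def)
  then have "det ?M\<^sup>T = c k"
    using cramer_lemma_mat[of "1\<^sub>m n" n "vec n c" k] k by simp
  then show ?thesis by (subst (asm) det_transpose[of _ n]) auto
qed

text \<open>Each basis vector is multiplied by a denominator of its own, a diagonal change of basis.
  This gives \<open>integral_basis_exists\<close> a first candidate for its minimisation.\<close>

lemma rat_basis_integral:
  assumes K: "number_field K"
  obtains b where "rat_basis K (degree_of K) b" "\<And>i. i < degree_of K \<Longrightarrow> b i \<in> ring_of_integers K"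
proof -
  define n where "n = degree_of K"
  obtain b where b: "rat_basis K n b" unfolding n_def using number_field_rat_basis[OF K] .
  have "\<exists>k::int. k > 0 \<and> of_int k * b i \<in> ring_of_integers K" if "i < n" for i
    using integral_multiple[OF K basis_mem[OF b that]] by metis
  then obtain k where k: "\<And>i. i < n \<Longrightarrow> k i > (0::int)" "\<And>i. i < n \<Longrightarrow> of_int (k i) * b i \<in> ring_of_integers K"
    by metis
  have "rat_basis K n (\<lambda>i. of_int (k i) * b i)"
  proof (rule rat_basis_change[OF b])
    show "of_int (k i) * b i = lincomb_rat n b (\<lambda>j. if i = j then of_int (k i) else 0)" if "i < n" for i
      using that by (simp add: lincomb_rat_def if_distrib[of of_rat] if_distrib[of "\<lambda>x. x * _"] cong: if_cong)
    have "det (mat n n (\<lambda>(i, j). if i = j then rat_of_int (k i) else 0)) = (\<Prod>i<n. of_int (k i))"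
      by (subst det_lower_triangular[of n]) (auto simp: prod_list_diag_prod atLeast0LessThan)
    then show "det (mat n n (\<lambda>(i, j). if i = j then rat_of_int (k i) else 0)) \<noteq> 0"
      using k(1) by (auto simp: less_imp_neq[symmetric])
  qed
  then show ?thesis using that k(2) by (simp add: n_def)
qed

text \<open>Among the rational bases consisting of integers, one with the least \<open>\<bar>gram_det\<bar>\<close> is integral:
  a coordinate with fractional part \<open>q \<noteq> 0\<close> would allow a change of basis which multiplies
  the determinant by \<open>q\<^sup>2 < 1\<close>.\<close>

lemma integral_basis_exists:
  assumes K: "number_field K"
  obtains b where "integral_basis K b"
proof -
  define n where "n = degree_of K"
  have sf: "is_subfield K" using K by (simp add: number_field_def)
  define good where "good b \<longleftrightarrow> rat_basis K n b \<and> (\<forall>i<n. b i \<in> ring_of_integers K)" for b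
  \<comment> \<open>On good bases the Gram determinant is an integer, so the floor loses nothing and
    a least value exists.\<close>
  define size where "size b = nat \<lfloor>\<bar>gram_det K n b\<bar>\<rfloor>" for b
  have size: "of_nat (size b) = \<bar>gram_det K n b\<bar>" if "good b" for b
  proof -
    have "gram_det K n b \<in> \<int>" using that gram_det_integer[OF K] by (simp add: good_def)
    then show ?thesis by (auto simp: size_def elim!: Ints_cases)
  qed
  obtain b0 where "good b0"
    using rat_basis_integral[OF K] unfolding good_def n_def by metis
  then obtain b where good: "good b" and min: "\<And>b'. good b' \<Longrightarrow> size b \<le> size b'"
    using ex_has_least_nat[of good b0 size] by blast
  have b: "rat_basis K n b" and bint: "\<And>i. i < n \<Longrightarrow> b i \<in> ring_of_integers K"
    using good by (auto simp: good_def)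
  have integer_coords: "coord n b x k \<in> \<int>" if x: "x \<in> ring_of_integers K" and k: "k < n" for x k
  proof (rule ccontr)
    \<comment> \<open>The coordinates of \<open>x\<close> after its \<open>k\<close>-th coordinate
      has been reduced to its fractional part; they become row \<open>k\<close> of the change of
      basis, whose determinant is then \<open>c k\<close>.\<close>
    define c where "c j = coord n b x j - (if j = k then of_int \<lfloor>coord n b x k\<rfloor> else 0)" for j
    define b' where "b' i = (if i = k then x - of_int \<lfloor>coord n b x k\<rfloor> * b k else b i)" for i
    define P where "P i j = (if i = k then c j else if i = j then 1 else 0)" for i j
    assume "coord n b x k \<notin> \<int>"
    then have q: "0 < c k" "c k < 1" by (auto simp: c_def frac_def[symmetric] frac_lt_1 frac_gt_0_iff)
    have P: "b' i = lincomb_rat n b (P i)" if "i < n" for i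
    proof (cases "i = k")
      case True
      have "lincomb_rat n b c = x - of_int \<lfloor>coord n b x k\<rfloor> * b k"
        using k lincomb_coord[OF b, of x] x unfolding c_def lincomb_rat_diff ring_of_integers_def
        by (simp add: lincomb_rat_def if_distrib[of of_rat] if_distrib[of "\<lambda>x. x * _"] cong: if_cong)
      moreover have "P k = c" by (simp add: P_def fun_eq_iff)
      ultimately show ?thesis by (simp add: b'_def True)
    next
      case False
      then show ?thesis
        using that by (simp add: b'_def P_def lincomb_rat_def if_distrib[of of_rat] if_distrib[of "\<lambda>x. x * _"] cong: if_cong)
    qed
    have det: "det (mat n n (\<lambda>(i, j). P i j)) = c k"
      unfolding P_def by (rule det_replace_row_one[OF k])
    have "rat_basis K n b'"
      using q P det by (intro rat_basis_change[OF b]) auto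
    moreover have "b' i \<in> ring_of_integers K" if "i < n" for i
      using that k x bint sf by (auto simp: b'_def intro!: ring_of_integers_diff ring_of_integers_mult ring_of_integers_of_int)
    ultimately have good': "good b'" by (simp add: good_def)
    have "gram_det K n b' = (c k)\<^sup>2 * gram_det K n b"
      using gram_det_change_basis[OF K _ P] basis_mem[OF b] det by simp
    moreover have "(c k)\<^sup>2 < 1" using q by (simp add: power_less_one_iff abs_square_less_1)
    ultimately have "\<bar>gram_det K n b'\<bar> < \<bar>gram_det K n b\<bar>"
      using gram_det_nonzero[OF K b] by (simp add: abs_mult)
    then have "size b' < size b"
      using size[OF good'] size[OF good] by (metis of_nat_less_iff)
    then show False using min[OF good'] by simp
  qed
  have "integral_basis K b"
    unfolding integral_basis_def n_def[symmetric] free_module_on_def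
  proof (intro conjI)
    show "ring_of_integers K = {\<Sum>i\<in>{..<n}. c i * b i |c. \<forall>i\<in>{..<n}. c i \<in> \<int>}"
    proof safe
      fix x assume x: "x \<in> ring_of_integers K"
      have "x = (\<Sum>i\<in>{..<n}. of_rat (coord n b x i) * b i)"
        using lincomb_coord[OF b, of x] x by (simp add: lincomb_rat_def ring_of_integers_def)
      moreover have "of_rat (coord n b x i) \<in> (\<int> :: 'a set)" if "i < n" for i
        using integer_coords[OF x that] by (auto elim!: Ints_cases)
      ultimately show "\<exists>c. x = (\<Sum>i\<in>{..<n}. c i * b i) \<and> (\<forall>i\<in>{..<n}. c i \<in> \<int>)"
        by (intro exI[of _ "\<lambda>i. of_rat (coord n b x i)"]) auto
    next
      fix c :: "nat \<Rightarrow> 'a" assume "\<forall>i\<in>{..<n}. c i \<in> \<int>"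
      then have "c i * b i \<in> ring_of_integers K" if "i < n" for i
        using that bint sf by (auto intro!: ring_of_integers_mult elim!: Ints_cases intro: ring_of_integers_of_int dest!: bspec[of _ _ i])
      then show "(\<Sum>i\<in>{..<n}. c i * b i) \<in> ring_of_integers K"
        using sf by (intro ring_of_integers_sum) auto
    qed
    show "\<forall>c. (\<forall>i\<in>{..<n}. c i \<in> \<int>) \<and> (\<Sum>i\<in>{..<n}. c i * b i) = 0 \<longrightarrow> (\<forall>i\<in>{..<n}. c i = 0)"
    proof (intro allI impI, elim conjE)
      fix c :: "nat \<Rightarrow> 'a"
      assume c: "\<forall>i\<in>{..<n}. c i \<in> \<int>" and z: "(\<Sum>i\<in>{..<n}. c i * b i) = 0"
      have "\<forall>i\<in>{..<n}. c i \<in> \<rat>" using c Ints_subset_Rats by blast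
      then show "\<forall>i\<in>{..<n}. c i = 0" using b z unfolding free_module_on_def by blast
    qed
  qed
  then show ?thesis by (rule that)
qed

section \<open>Quadratic extensions\<close>

text \<open>Used both for the field \<open>K(s)\<close> and for the module
  \<open>O_K + O_K \<eta>\<close>.\<close>

definition quad_ext :: "'a::comm_ring_1 set \<Rightarrow> 'a \<Rightarrow> 'a set" where
  "quad_ext R t = {x + y * t | x y. x \<in> R \<and> y \<in> R}"

lemma quad_extI: "x \<in> R \<Longrightarrow> y \<in> R \<Longrightarrow> x + y * t \<in> quad_ext R t"
  by (auto simp: quad_ext_def)

lemma quad_extE:
  assumes "z \<in> quad_ext R t"
  obtains x y where "x \<in> R" "y \<in> R" "z = x + y * t"
  using assms by (auto simp: quad_ext_def)

text \<open>The index set is doubled along an arbitrary injection \<open>g\<close>, to cover two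
  cases: \<open>g = (+) n\<close> for rational and integral bases given as tuples, and
  \<open>g = insert a\<close> for the elements \<open>\<eta>_T\<close> indexed by subsets.\<close>

lemma free_module_on_quad_ext:
  assumes e: "free_module_on R M I e" and I: "finite I" "inj_on g I" "I \<inter> g ` I = {}"
    and direct: "\<And>x y. x \<in> M \<Longrightarrow> y \<in> M \<Longrightarrow> x + y * t = 0 \<Longrightarrow> x = 0 \<and> y = 0"
    and e': "\<And>i. i \<in> I \<Longrightarrow> e' i = e i" "\<And>i. i \<in> I \<Longrightarrow> e' (g i) = e i * t"
  shows "free_module_on R (quad_ext M t) (I \<union> g ` I) e'"
proof -
  have M: "M = {\<Sum>i\<in>I. c i * e i | c. \<forall>i\<in>I. c i \<in> R}"
    and indep: "\<And>c. \<forall>i\<in>I. c i \<in> R \<Longrightarrow> (\<Sum>i\<in>I. c i * e i) = 0 \<Longrightarrow> \<forall>i\<in>I. c i = 0"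
    using e unfolding free_module_on_def by blast+
  have split: "(\<Sum>i\<in>I \<union> g ` I. c i * e' i) = (\<Sum>i\<in>I. c i * e i) + (\<Sum>i\<in>I. c (g i) * e i) * t" for c
  proof -
    have "(\<Sum>i\<in>I \<union> g ` I. c i * e' i) = (\<Sum>i\<in>I. c i * e' i) + (\<Sum>i\<in>I. c (g i) * e' (g i))"
      using I by (simp add: sum.union_disjoint sum.reindex)
    also have "\<dots> = (\<Sum>i\<in>I. c i * e i) + (\<Sum>i\<in>I. c (g i) * e i * t)"
      using e' by (simp add: mult.assoc)
    finally show ?thesis by (simp only: sum_distrib_right)
  qed
  have inM: "(\<Sum>i\<in>I. c i * e i) \<in> M" if "\<And>i. i \<in> I \<Longrightarrow> c i \<in> R" for c
    using that unfolding M by blast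
  show ?thesis
    unfolding free_module_on_def
  proof (intro conjI allI impI)
    show "quad_ext M t = {\<Sum>i\<in>I \<union> g ` I. c i * e' i | c. \<forall>i\<in>I \<union> g ` I. c i \<in> R}"
    proof safe
      fix z assume "z \<in> quad_ext M t"
      then obtain x y where xy: "x \<in> M" "y \<in> M" "z = x + y * t" by (rule quad_extE)
      obtain c d where c: "x = (\<Sum>i\<in>I. c i * e i)" "\<forall>i\<in>I. c i \<in> R"
        and d: "y = (\<Sum>i\<in>I. d i * e i)" "\<forall>i\<in>I. d i \<in> R"
        using xy(1,2) unfolding M by blast
      define f where "f k = (if k \<in> I then c k else d (the_inv_into I g k))" for k
      have f: "f i = c i" "f (g i) = d i" if "i \<in> I" for i
        using that I by (auto simp: f_def the_inv_into_f_f)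
      have "z = (\<Sum>i\<in>I \<union> g ` I. f i * e' i)"
        unfolding split using xy(3) c(1) d(1) f by simp
      moreover have "\<forall>i\<in>I \<union> g ` I. f i \<in> R" using f c(2) d(2) by auto
      ultimately show "\<exists>c. z = (\<Sum>i\<in>I \<union> g ` I. c i * e' i) \<and> (\<forall>i\<in>I \<union> g ` I. c i \<in> R)" by blast
    next
      fix c assume "\<forall>i\<in>I \<union> g ` I. c i \<in> R"
      then show "(\<Sum>i\<in>I \<union> g ` I. c i * e' i) \<in> quad_ext M t"
        unfolding split by (intro quad_extI inM) auto
    qed
  next
    fix c assume c: "(\<forall>i\<in>I \<union> g ` I. c i \<in> R) \<and> (\<Sum>i\<in>I \<union> g ` I. c i * e' i) = 0"
    then have z: "(\<Sum>i\<in>I. c i * e i) = 0 \<and> (\<Sum>i\<in>I. c (g i) * e i) = 0"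
      unfolding split by (intro direct inM) auto
    have "\<forall>i\<in>I. c i = 0" by (rule indep) (use c z in blast)+
    moreover have "\<forall>i\<in>I. c (g i) = 0" by (rule indep) (use c z in blast)+
    ultimately show "\<forall>i\<in>I \<union> g ` I. c i = 0" by blast
  qed
qed

definition double_basis :: "nat \<Rightarrow> (nat \<Rightarrow> 'a::comm_ring_1) \<Rightarrow> 'a \<Rightarrow> nat \<Rightarrow> 'a" where
  "double_basis n b t i = (if i < n then b i else b (i - n) * t)"

lemma free_module_on_double_basis:
  assumes "free_module_on R M {..<n} b"
    and "\<And>x y. x \<in> M \<Longrightarrow> y \<in> M \<Longrightarrow> x + y * t = 0 \<Longrightarrow> x = 0 \<and> y = 0"
  shows "free_module_on R (quad_ext M t) {..<2 * n} (double_basis n b t)"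
proof -
  have "{..<2 * n} = {..<n} \<union> (+) n ` {..<n}"
    by (auto simp: image_iff) (metis add_diff_inverse_nat lessThan_iff mult_2 nat_add_left_cancel_less)
  moreover have "free_module_on R (quad_ext M t) ({..<n} \<union> (+) n ` {..<n}) (double_basis n b t)"
    using assms by (intro free_module_on_quad_ext[of R M _ b]) (auto simp: double_basis_def)
  ultimately show ?thesis by simp
qed

lemma sum_lessThan_double:
  fixes f :: "nat \<Rightarrow> 'a::comm_monoid_add"
  shows "(\<Sum>i<2 * n. f i) = (\<Sum>i<n. f i) + (\<Sum>i<n. f (n + i))"
proof -
  have "(\<Sum>i<n + m. f i) = (\<Sum>i<n. f i) + (\<Sum>i<m. f (n + i))" for m
    by (induction m) (simp_all add: add.assoc)
  then show ?thesis by (simp only: mult_2)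
qed

lemma quad_ext_direct:
  assumes "is_subfield K" "s \<notin> K" "x \<in> K" "y \<in> K" "x + y * s = 0"
  shows "x = 0 \<and> y = 0"
proof -
  have "y = 0"
  proof (rule ccontr)
    assume "y \<noteq> 0"
    then have "s = - x / y" using assms(5) by (simp add: field_simps eq_neg_iff_add_eq_0)
    then show False using assms by (metis subfield_divide subfield_uminus)
  qed
  then show ?thesis using assms(5) by simp
qed

lemma quad_ext_subfield:
  assumes K: "is_subfield K" and s: "s \<notin> K" and w: "s\<^sup>2 \<in> K"
  shows "is_subfield (quad_ext K s)"
  unfolding is_subfield_def
proof (intro conjI ballI)
  show "0 \<in> quad_ext K s" "1 \<in> quad_ext K s"
    using quad_extI[of 0 K 0 s] quad_extI[of 1 K 0 s] K by (simp_all add: subfield_intros)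
next
  fix z z' assume z: "z \<in> quad_ext K s" and z': "z' \<in> quad_ext K s"
  obtain x y where xy: "x \<in> K" "y \<in> K" "z = x + y * s" using z by (rule quad_extE)
  obtain x' y' where xy': "x' \<in> K" "y' \<in> K" "z' = x' + y' * s" using z' by (rule quad_extE)
  have "z + z' = (x + x') + (y + y') * s" by (simp add: xy xy' algebra_simps)
  moreover have "z * z' = (x * x' + y * y' * s\<^sup>2) + (x * y' + y * x') * s"
    by (simp add: xy xy' algebra_simps power2_eq_square)
  ultimately show "z + z' \<in> quad_ext K s" "z * z' \<in> quad_ext K s"
    using xy xy' K w by (simp_all only: quad_extI subfield_add subfield_mult)
next
  fix z assume z: "z \<in> quad_ext K s"
  obtain x y where xy: "x \<in> K" "y \<in> K" "z = x + y * s" using z by (rule quad_extE)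
  have "- z = - x + (- y) * s" by (simp add: xy)
  then show "- z \<in> quad_ext K s"
    using xy K by (simp only: quad_extI subfield_uminus)
  \<comment> \<open>The relative norm of \<open>z\<close>. It is nonzero for
    \<open>z \<noteq> 0\<close> because the conjugate \<open>x - y s\<close> cannot vanish either,
    and it provides the inverse.\<close>
  define d where "d = x\<^sup>2 - y\<^sup>2 * s\<^sup>2"
  have d: "(x + y * s) * (x - y * s) = d" by (simp add: d_def algebra_simps power2_eq_square)
  have dK: "d \<in> K" unfolding d_def using xy K w by (auto intro!: subfield_diff subfield_mult subfield_power)
  show "inverse z \<in> quad_ext K s"
  proof (cases "z = 0")
    case True
    then show ?thesis using quad_extI[of 0 K 0 s] K by (simp add: subfield_0)
  next
    case False
    have "x - y * s \<noteq> 0"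
    proof
      assume "x - y * s = 0"
      then have "x = 0 \<and> - y = 0" using xy K s by (intro quad_ext_direct[of K s]) (auto simp: subfield_uminus)
      then show False using False xy by simp
    qed
    then have "d \<noteq> 0" using False xy d by auto
    then have "inverse z = x / d + (- y / d) * s"
      using d False xy by (simp add: field_simps)
    then show ?thesis
      using xy K dK by (simp only: quad_extI subfield_divide subfield_uminus)
  qed
qed

section \<open>Adjoining one square root, and conjugation\<close>

lemma adjoin_subfield: "is_subfield (adjoin K S)"
  unfolding adjoin_def is_subfield_def by blast

lemma adjoin_eq_quad_ext:
  assumes K: "is_subfield K" and s: "s \<notin> K" and w: "s\<^sup>2 \<in> K"
  shows "adjoin K {s} = quad_ext K s"
proof
  have "s \<in> quad_ext K s" "K \<subseteq> quad_ext K s"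
    using quad_extI[of 0 K 1 s] quad_extI[of _ K 0 s] K by (auto simp: subfield_0 subfield_1)
  then show "adjoin K {s} \<subseteq> quad_ext K s"
    using quad_ext_subfield[OF assms] by (auto simp: adjoin_def)
  show "quad_ext K s \<subseteq> adjoin K {s}"
    by (auto simp: adjoin_def elim!: quad_extE intro!: subfield_add subfield_mult)
qed

text \<open>Evaluation of a polynomial over \<open>K\<close> commutes with conjugation
  \<open>x + y s \<mapsto> x - y s\<close>. Asking for a common pair \<open>x\<close>,
  \<open>y\<close> makes an induction along Horner's scheme possible, with no need to define
  conjugation as a map.\<close>

lemma poly_conjugate:
  assumes K: "is_subfield K" and w: "s\<^sup>2 \<in> K" and ab: "a \<in> K" "b \<in> K" and p: "\<And>i. coeff p i \<in> K"
  shows "\<exists>x\<in>K. \<exists>y\<in>K. poly p (a + b * s) = x + y * s \<and> poly p (a - b * s) = x - y * s"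
  using p
proof (induction p)
  case 0
  then show ?case using K by (auto intro!: bexI[of _ 0] simp: subfield_0)
next
  case (pCons c p)
  have "coeff p i \<in> K" for i using pCons.prems[of "Suc i"] by simp
  then obtain x y where xy: "x \<in> K" "y \<in> K"
    "poly p (a + b * s) = x + y * s" "poly p (a - b * s) = x - y * s"
    using pCons.IH by blast
  have c: "c \<in> K" using pCons.prems[of 0] by simp
  show ?case
  proof (intro bexI conjI)
    show "poly (pCons c p) (a + b * s) = (c + a * x + b * y * s\<^sup>2) + (a * y + b * x) * s"
      unfolding poly_pCons xy(3) by (simp add: algebra_simps power2_eq_square)
    show "poly (pCons c p) (a - b * s) = (c + a * x + b * y * s\<^sup>2) - (a * y + b * x) * s"
      unfolding poly_pCons xy(4) by (simp add: algebra_simps power2_eq_square)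
    show "c + a * x + b * y * s\<^sup>2 \<in> K" "a * y + b * x \<in> K"
      using xy(1,2) c ab K w by (simp_all only: subfield_add subfield_mult)
  qed
qed

text \<open>Conjugate elements are roots of the same monic integer polynomial.\<close>

lemma algebraic_int_conjugate:
  fixes K :: "'a::field_char_0 set"
  assumes K: "is_subfield K" and s: "s \<notin> K" and w: "s\<^sup>2 \<in> K" and ab: "a \<in> K" "b \<in> K"
    and "algebraic_int (a + b * s)"
  shows "algebraic_int (a - b * s)"
proof -
  obtain p where p: "poly (map_poly of_int p) (a + b * s) = 0" "lead_coeff p = 1"
    using assms(6) unfolding algebraic_int_altdef_ipoly by blast
  obtain x y where xy: "x \<in> K" "y \<in> K" "poly (map_poly of_int p) (a + b * s) = x + y * s"
    "poly (map_poly of_int p) (a - b * s) = x - y * s"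
    using poly_conjugate[OF K w ab, of "map_poly of_int p"] K by (auto simp: coeff_map_poly subfield_of_int)
  have "x = 0 \<and> y = 0" using quad_ext_direct[OF K s xy(1,2)] xy(3) p(1) by simp
  then show ?thesis
    unfolding algebraic_int_altdef_ipoly using xy(4) p(2) by auto
qed

text \<open>If \<open>a + b s\<close> is integral, so is its conjugate, and hence \<open>2 b s\<close>; as \<open>s\<close> is a unit, \<open>2 b\<close> is
  integral, and \<open>a + b s = (a - b u) + 2 b \<eta>\<close>.\<close>

lemma ring_of_integers_quad_ext:
  assumes K: "is_subfield K" and s: "s \<notin> K" and w: "s\<^sup>2 \<in> unit_group (ring_of_integers K)"
    and u: "u \<in> ring_of_integers K" and cong: "cong_mod (ring_of_integers K) 4 (s\<^sup>2) (u\<^sup>2)"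
  shows "ring_of_integers (quad_ext K s) = quad_ext (ring_of_integers K) ((u + s) / 2)"
proof -
  let ?O = "ring_of_integers K" and ?\<eta> = "(u + s) / 2"
  obtain v where v: "v \<in> ?O" "s\<^sup>2 * v = 1" and wO: "s\<^sup>2 \<in> ?O" using w by (auto simp: unit_group_def)
  then have wK: "s\<^sup>2 \<in> K" by (simp add: ring_of_integers_def)
  obtain z where z: "z \<in> ?O" "s\<^sup>2 - u\<^sup>2 = 4 * z" using cong by (auto simp: cong_mod_def)
  have uK: "u \<in> K" and uint: "algebraic_int u" using u by (auto simp: ring_of_integers_def)
  have zint: "algebraic_int z" using z(1) by (simp add: ring_of_integers_def)
  \<comment> \<open>The aim is that \<open>\<eta>\<close> is a root of \<open>T^2 - u T - z\<close>.
    The congruence modulo 4 is exactly what makes \<open>z = (s^2 - u^2) / 4\<close>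
    integral.\<close>
  have "4 * ?\<eta>\<^sup>2 = (2 * ?\<eta>)\<^sup>2" by (simp only: power_mult_distrib) simp
  also have "\<dots> = (s\<^sup>2 - u\<^sup>2) + 2 * u * (u + s)" by (simp add: power2_eq_square algebra_simps)
  also have "\<dots> = 4 * (u * ?\<eta> + z)" unfolding z(2) by (simp add: distrib_left)
  finally have "4 * ?\<eta>\<^sup>2 = 4 * (u * ?\<eta> + z)" .
  then have "?\<eta>\<^sup>2 = u * ?\<eta> + z"
    by (simp only: mult_cancel_left) simp
  then have eta: "algebraic_int ?\<eta>"
    by (rule algebraic_int_quadratic[OF uint zint])
  have sint: "algebraic_int s"
    by (rule algebraic_int_quadratic[of 0 "s\<^sup>2"]) (use wO in \<open>auto simp: ring_of_integers_def\<close>)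
  have two: "2 \<in> K" using subfield_of_int[OF K, of 2] by simp
  show ?thesis
  proof
    show "quad_ext ?O ?\<eta> \<subseteq> ring_of_integers (quad_ext K s)"
    proof
      fix t assume "t \<in> quad_ext ?O ?\<eta>"
      then obtain x y where xy: "x \<in> ?O" "y \<in> ?O" "t = x + y * ?\<eta>" by (rule quad_extE)
      have "t = (x + y * u / 2) + (y / 2) * s" using xy(3) by (simp add: field_simps)
      moreover have "x + y * u / 2 \<in> K" "y / 2 \<in> K"
        using xy uK two K by (auto simp: ring_of_integers_def intro!: subfield_add subfield_divide subfield_mult)
      ultimately have "t \<in> quad_ext K s" by (simp only: quad_extI)
      moreover have "algebraic_int t"
        unfolding xy(3) using xy(1,2)
        by (intro algebraic_int_add algebraic_int_mult eta) (auto simp: ring_of_integers_def)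
      ultimately show "t \<in> ring_of_integers (quad_ext K s)" by (simp add: ring_of_integers_def)
    qed
    show "ring_of_integers (quad_ext K s) \<subseteq> quad_ext ?O ?\<eta>"
    proof
      fix t assume "t \<in> ring_of_integers (quad_ext K s)"
      then have tint: "algebraic_int t" and "t \<in> quad_ext K s" by (auto simp: ring_of_integers_def)
      then obtain a b where ab: "a \<in> K" "b \<in> K" "t = a + b * s" by (auto elim: quad_extE)
      have "algebraic_int (a - b * s)"
        using algebraic_int_conjugate[OF K s wK ab(1,2)] tint ab(3) by simp
      then have "algebraic_int ((t - (a - b * s)) * s * v)"
        using v(1) by (intro algebraic_int_mult algebraic_int_diff[OF tint] sint) (auto simp: ring_of_integers_def)
      also have "(t - (a - b * s)) * s * v = 2 * b * (s\<^sup>2 * v)"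
        using ab(3) by (simp add: algebra_simps power2_eq_square)
      finally have d: "2 * b \<in> ?O"
        using v(2) ab(2) two K by (simp add: ring_of_integers_def subfield_mult)
      have t: "t = (a - b * u) + 2 * b * ?\<eta>" using ab(3) by (simp add: field_simps)
      then have "a - b * u = t - 2 * b * ?\<eta>" by simp
      also have "algebraic_int \<dots>"
        using d by (intro algebraic_int_diff[OF tint] algebraic_int_mult[OF _ eta]) (simp add: ring_of_integers_def)
      finally have "a - b * u \<in> ?O"
        using ab uK K by (simp add: ring_of_integers_def subfield_diff subfield_mult)
      then show "t \<in> quad_ext ?O ?\<eta>" using d unfolding t by (rule quad_extI)
    qed
  qed
qed

text \<open>Doubling turns a relation between \<open>1\<close> and \<open>\<eta>\<close> into one
  between \<open>1\<close> and \<open>s\<close>.\<close>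

lemma ring_of_integers_direct:
  fixes K :: "'a::field_char_0 set"
  assumes K: "is_subfield K" and s: "s \<notin> K" and u: "u \<in> K"
    and xy: "x \<in> ring_of_integers K" "y \<in> ring_of_integers K" and z: "x + y * ((u + s) / 2) = 0"
  shows "x = 0 \<and> y = 0"
proof -
  have xyK: "x \<in> K" "y \<in> K" using xy by (auto simp: ring_of_integers_def)
  have "(2 * x + y * u) + y * s = 2 * (x + y * ((u + s) / 2))" by (simp add: field_simps)
  then have "(2 * x + y * u) + y * s = 0" unfolding z by simp
  moreover have "2 * x + y * u \<in> K"
    using xyK u K subfield_of_int[OF K, of 2] by (auto intro!: subfield_add subfield_mult)
  ultimately have "2 * x + y * u = 0 \<and> y = 0"
    using quad_ext_direct[OF K s] xyK by blast
  then show ?thesis by auto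
qed

section \<open>Trace and discriminant of a quadratic extension\<close>

lemma lincomb_double_basis:
  "lincomb_rat (2 * n) (double_basis n b t) c =
     lincomb_rat n b c + lincomb_rat n b (\<lambda>i. c (n + i)) * t"
  unfolding lincomb_rat_def sum_lessThan_double
  by (simp add: double_basis_def sum_distrib_right mult.assoc)

lemma rat_basis_double_basis:
  assumes "is_subfield K" "rat_basis K n b" "s \<notin> K"
  shows "rat_basis (quad_ext K s) (2 * n) (double_basis n b s)"
  using assms by (intro free_module_on_double_basis quad_ext_direct)

lemma coord_double_basis:
  assumes K: "is_subfield K" and b: "rat_basis K n b" and s: "s \<notin> K"
    and xy: "x \<in> K" "y \<in> K" and i: "i < 2 * n"
  shows "coord (2 * n) (double_basis n b s) (x + y * s) i =
    (if i < n then coord n b x i else coord n b y (i - n))"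
proof -
  define c where "c i = (if i < n then coord n b x i else coord n b y (i - n))" for i
  have "lincomb_rat n b c = lincomb_rat n b (coord n b x)"
    "lincomb_rat n b (\<lambda>i. c (n + i)) = lincomb_rat n b (coord n b y)"
    by (simp_all add: lincomb_rat_def c_def)
  then have "lincomb_rat (2 * n) (double_basis n b s) c = x + y * s"
    by (simp add: lincomb_double_basis lincomb_coord[OF b] xy)
  then have "coord (2 * n) (double_basis n b s) (x + y * s) i = c i"
    using coord_lincomb[OF rat_basis_double_basis[OF K b s] i, of c] by simp
  then show ?thesis by (simp add: c_def)
qed

text \<open>In the basis \<open>b, b s\<close>, multiplication by \<open>x\<close> acts as two
  diagonal copies of multiplication by \<open>x\<close> on \<open>K\<close>, while
  \<open>y s\<close> exchanges the two halves and contributes nothing to the diagonal.\<close>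

lemma field_trace_quad_ext:
  assumes K: "number_field K" and s: "s \<notin> K" "s\<^sup>2 \<in> K" and xy: "x \<in> K" "y \<in> K"
  shows "field_trace (quad_ext K s) (x + y * s) = 2 * field_trace K x"
proof -
  obtain n b where sf: "is_subfield K" and b: "rat_basis K n b"
    using K by (auto simp: number_field_iff)
  let ?d = "double_basis n b s"
  have "field_trace (quad_ext K s) (x + y * s) = (\<Sum>i<2 * n. coord (2 * n) ?d ((x + y * s) * ?d i) i)"
    using quad_ext_subfield[OF sf s] rat_basis_double_basis[OF sf b s(1)] xy
    by (intro field_trace_eq quad_extI)
  also have "\<dots> = (\<Sum>i<n. coord n b (x * b i) i) + (\<Sum>i<n. coord n b (x * b i) i)"
    unfolding sum_lessThan_double
  proof (intro arg_cong2[of _ _ _ _ "(+)"] sum.cong refl)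
    fix i assume "i \<in> {..<n}"
    then have i: "i < n" by simp
    have m: "x * b i \<in> K" "y * b i \<in> K" "y * b i * s\<^sup>2 \<in> K"
      using sf xy s basis_mem[OF b i] by (auto intro!: subfield_mult)
    have 1: "(x + y * s) * ?d i = x * b i + y * b i * s"
      using i by (simp add: double_basis_def algebra_simps)
    show "coord (2 * n) ?d ((x + y * s) * ?d i) i = coord n b (x * b i) i"
      unfolding 1 using i by (subst coord_double_basis[OF sf b s(1) m(1,2)]) auto
    have 2: "(x + y * s) * ?d (n + i) = y * b i * s\<^sup>2 + x * b i * s"
      using i by (simp add: double_basis_def algebra_simps power2_eq_square)
    show "coord (2 * n) ?d ((x + y * s) * ?d (n + i)) (n + i) = coord n b (x * b i) i"
      unfolding 2 using i by (subst coord_double_basis[OF sf b s(1) m(3,1)]) auto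
  qed
  also have "\<dots> = 2 * field_trace K x" using xy by (simp add: field_trace_eq[OF sf b])
  finally show ?thesis .
qed

lemma number_field_quad_ext:
  assumes K: "number_field K" and s: "s \<notin> K" "s\<^sup>2 \<in> K"
  shows "number_field (quad_ext K s)" "degree_of (quad_ext K s) = 2 * degree_of K"
proof -
  obtain b where b: "rat_basis K (degree_of K) b" using number_field_rat_basis[OF K] .
  have sf: "is_subfield K" using K by (simp add: number_field_def)
  note d = rat_basis_double_basis[OF sf b s(1)]
  show "number_field (quad_ext K s)"
    using quad_ext_subfield[OF sf s] d unfolding number_field_iff by blast
  show "degree_of (quad_ext K s) = 2 * degree_of K" by (rule degree_of_eq[OF d])
qed

text \<open>Multiplication by a unit maps an integral basis to an integral basis.\<close>

lemma gram_det_unit_mult: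
  assumes K: "number_field K" and b: "free_module_on \<int> (ring_of_integers K) {..<n} b"
    and w: "w \<in> unit_group (ring_of_integers K)"
  shows "\<bar>det (mat n n (\<lambda>(i, j). field_trace K (w * b i * b j)))\<bar> = \<bar>gram_det K n b\<bar>"
proof -
  let ?O = "ring_of_integers K"
  have sf: "is_subfield K" using K by (simp add: number_field_def)
  obtain v where v: "w \<in> ?O" "v \<in> ?O" "w * v = 1" using w by (auto simp: unit_group_def)
  have bO: "b i \<in> ?O" if "i < n" for i using free_module_on_mem[OF b, of i] that by auto
  then have bK: "b i \<in> K" if "i < n" for i using that ring_of_integers_subset by auto
  have "\<exists>P. \<forall>i\<in>{..<n}. w * b i = (\<Sum>j<n. of_int (P i j) * b j)"
    using bO v sf by (intro bchoice ballI int_basis_coords[OF b] ring_of_integers_mult) auto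
  then obtain P where P: "\<And>i. i < n \<Longrightarrow> w * b i = (\<Sum>j<n. of_int (P i j) * b j)" by blast
  have "\<exists>Q. \<forall>i\<in>{..<n}. v * b i = (\<Sum>j<n. of_int (Q i j) * b j)"
    using bO v sf by (intro bchoice ballI int_basis_coords[OF b] ring_of_integers_mult) auto
  then obtain Q where Q: "\<And>i. i < n \<Longrightarrow> v * b i = (\<Sum>j<n. of_int (Q i j) * b j)" by blast
  \<comment> \<open>The inverse \<open>v\<close> of \<open>w\<close> supplies the inverse change of
    basis: multiply the expansion of \<open>v * b i\<close> by \<open>w\<close>.\<close>
  have Q': "b i = (\<Sum>j<n. of_int (Q i j) * (w * b j))" if "i < n" for i
  proof -
    have "b i = w * (v * b i)" using v(3) by (simp flip: mult.assoc)
    also have "\<dots> = (\<Sum>j<n. of_int (Q i j) * (w * b j))"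
      unfolding Q[OF that] by (simp add: sum_distrib_left mult.left_commute)
    finally show ?thesis .
  qed
  define M where "M = mat n n (\<lambda>(i, j). rat_of_int (P i j))"
  define G where "G = mat n n (\<lambda>(i, j). field_trace K (b i * b j))"
  have "M = map_mat of_int (mat n n (\<lambda>(i, j). P i j))" by (intro eq_matI) (auto simp: M_def)
  then have "\<bar>det M\<bar> = 1"
    using int_basis_change_det[OF b P Q'] by (simp add: of_int_hom.hom_det flip: of_int_abs)
  moreover have "mat n n (\<lambda>(i, j). field_trace K (w * b i * b j)) = M * G" (is "?G' = _")
  proof (rule eq_matI)
    fix i j assume "i < dim_row (M * G)" "j < dim_col (M * G)"
    then have ij: "i < n" "j < n" by (auto simp: M_def G_def)
    have "w * b i * b j = (\<Sum>k<n. of_rat (of_int (P i k)) * (b k * b j))"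
      unfolding P[OF ij(1)] by (simp add: sum_distrib_right mult.assoc)
    then have "field_trace K (w * b i * b j) = (\<Sum>k<n. of_int (P i k) * field_trace K (b k * b j))"
      using bK ij sf by (simp only:) (intro field_trace_lincomb[OF K] subfield_mult; simp)
    then show "?G' $$ (i, j) = (M * G) $$ (i, j)"
      using ij by (simp add: M_def G_def scalar_prod_def atLeast0LessThan)
  qed (auto simp: M_def G_def)
  moreover have "M \<in> carrier_mat n n" "G \<in> carrier_mat n n" by (auto simp: M_def G_def)
  ultimately show ?thesis
    by (simp add: det_mult[of _ n] abs_mult gram_det_def G_def)
qed

text \<open>Products of one vector from each half lie in \<open>K s\<close> and have trace 0, so the
  Gram matrix is block diagonal. Each block is twice a matrix of traces from \<open>K\<close>, which
  accounts for a factor \<open>2 ^ n\<close> per block.\<close>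

lemma gram_det_double_basis:
  assumes K: "number_field K" and s: "s \<notin> K" "s\<^sup>2 \<in> K" and b: "\<And>i. i < n \<Longrightarrow> b i \<in> K"
  shows "gram_det (quad_ext K s) (2 * n) (double_basis n b s) =
    (2 ^ n)\<^sup>2 * gram_det K n b * det (mat n n (\<lambda>(i, j). field_trace K (s\<^sup>2 * b i * b j)))"
proof -
  let ?K = "quad_ext K s" and ?d = "double_basis n b s"
  have sf: "is_subfield K" using K by (simp add: number_field_def)
  define G where "G = mat n n (\<lambda>(i, j). field_trace K (b i * b j))"
  define H where "H = mat n n (\<lambda>(i, j). field_trace K (s\<^sup>2 * b i * b j))"
  have tr: "field_trace ?K x = 2 * field_trace K x" if "x \<in> K" for x
    using field_trace_quad_ext[OF K s that subfield_0[OF sf]] by simp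
  have tr0: "field_trace ?K (x * s) = 0" if "x \<in> K" for x
    using field_trace_quad_ext[OF K s subfield_0[OF sf] that] field_trace_0[OF K] by simp
  have bb: "b i * b j \<in> K" "s\<^sup>2 * b i * b j \<in> K" if "i < n" "j < n" for i j
    using b that s sf by (auto intro!: subfield_mult)
  have "mat (2 * n) (2 * n) (\<lambda>(i, j). field_trace ?K (?d i * ?d j)) =
      four_block_mat (2 \<cdot>\<^sub>m G) (0\<^sub>m n n) (0\<^sub>m n n) (2 \<cdot>\<^sub>m H)" (is "?A = ?B")
  proof (rule eq_matI)
    fix i j assume "i < dim_row ?B" "j < dim_col ?B"
    then have ij: "i < 2 * n" "j < 2 * n" by (auto simp: G_def H_def)
    consider "i < n" "j < n" | "i < n" "\<not> j < n" | "\<not> i < n" "j < n" | "\<not> i < n" "\<not> j < n" by blast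
    then show "?A $$ (i, j) = ?B $$ (i, j)"
    proof cases
      case 1
      then show ?thesis using ij bb[of i j] by (simp add: double_basis_def G_def H_def tr)
    next
      case 2
      then show ?thesis
        using ij tr0[of "b i * b (j - n)"] bb[of i "j - n"]
        by (simp add: double_basis_def G_def H_def mult.assoc)
    next
      case 3
      then have "?d i * ?d j = b (i - n) * b j * s" by (simp add: double_basis_def mult_ac)
      then show ?thesis
        using 3 ij tr0[of "b (i - n) * b j"] bb[of "i - n" j] by (simp add: G_def H_def)
    next
      case 4
      then have "?d i * ?d j = s\<^sup>2 * b (i - n) * b (j - n)"
        by (simp add: double_basis_def power2_eq_square mult_ac)
      then show ?thesis
        using 4 ij tr bb[of "i - n" "j - n"] by (simp add: G_def H_def)
    qed
  qed (auto simp: G_def H_def)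
  moreover have "det ?B = det (2 \<cdot>\<^sub>m G) * det (2 \<cdot>\<^sub>m H)"
    by (rule det_four_block_mat_upper_right_zero[of _ n _ n]) (auto simp: G_def H_def)
  ultimately show ?thesis
    by (simp add: gram_det_def det_smult G_def[symmetric] H_def[symmetric])
       (simp add: G_def H_def power2_eq_square mult_ac)
qed

text \<open>From \<open>s = 2 \<eta> - u\<close> one gets
  \<open>b k s = - u b k + 2 b k \<eta>\<close>. Expanding \<open>u b k\<close> in \<open>b\<close>
  yields a lower triangular matrix with \<open>n\<close> ones and \<open>n\<close> twos on the
  diagonal.\<close>

lemma gram_det_double_basis_shift:
  assumes K: "number_field K" and s: "s \<notin> K" "s\<^sup>2 \<in> K" and b: "rat_basis K n b" and u: "u \<in> K"
  shows "gram_det (quad_ext K s) (2 * n) (double_basis n b s) =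
    (2 ^ n)\<^sup>2 * gram_det (quad_ext K s) (2 * n) (double_basis n b ((u + s) / 2))"
proof -
  let ?\<eta> = "(u + s) / 2"
  have sf: "is_subfield K" using K by (simp add: number_field_def)
  define P where "P i j = (if i < n then (if i = j then 1 else 0)
    else if j < n then - coord n b (u * b (i - n)) j else if i = j then 2 else (0 :: rat))" for i j
  have "det (mat (2 * n) (2 * n) (\<lambda>(i, j). P i j)) = (\<Prod>i<2 * n. P i i)"
    by (subst det_lower_triangular[of "2 * n"]) (auto simp: P_def prod_list_diag_prod atLeast0LessThan)
  also have "\<dots> = (\<Prod>i<n. P i i) * (\<Prod>i<n. P (n + i) (n + i))"
  proof -
    have "(\<Prod>i<n + m. P i i) = (\<Prod>i<n. P i i) * (\<Prod>i<m. P (n + i) (n + i))" for m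
      by (induction m) (simp_all add: mult.assoc)
    then show ?thesis by (simp only: mult_2)
  qed
  also have "\<dots> = 2 ^ n" by (simp add: P_def)
  finally have det: "det (mat (2 * n) (2 * n) (\<lambda>(i, j). P i j)) = 2 ^ n" .
  have eq: "double_basis n b s i = lincomb_rat (2 * n) (double_basis n b ?\<eta>) (P i)" if i: "i < 2 * n" for i
  proof (cases "i < n")
    case True
    have "lincomb_rat n b (P i) = b i" "lincomb_rat n b (\<lambda>j. P i (n + j)) = 0"
      using True by (simp_all add: lincomb_rat_def P_def if_distrib[of of_rat] if_distrib[of "\<lambda>x. x * _"] cong: if_cong)
    then show ?thesis using True by (simp add: lincomb_double_basis double_basis_def)
  next
    case False
    define k where "k = i - n"
    have k: "k < n" "i = n + k" using False i by (auto simp: k_def)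
    have "lincomb_rat n b (P i) = lincomb_rat n b (\<lambda>j. - 1 * coord n b (u * b k) j)"
      by (simp add: lincomb_rat_def P_def k)
    also have "\<dots> = - (u * b k)"
      unfolding lincomb_rat_scale using lincomb_coord[OF b, of "u * b k"] u basis_mem[OF b k(1)] sf
      by (simp add: subfield_mult of_rat_minus)
    finally have 1: "lincomb_rat n b (P i) = - (u * b k)" .
    have 2: "lincomb_rat n b (\<lambda>j. P i (n + j)) = 2 * b k"
      using k by (simp add: lincomb_rat_def P_def if_distrib[of of_rat] if_distrib[of "\<lambda>x. x * _"] cong: if_cong)
    show ?thesis
      unfolding lincomb_double_basis 1 2 using k by (simp add: double_basis_def algebra_simps)
  qed
  have mem: "double_basis n b ?\<eta> i \<in> quad_ext K s" if "i < 2 * n" for i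
  proof (cases "i < n")
    case True
    then show ?thesis
      using quad_extI[of "b i" K 0 s] basis_mem[OF b] sf by (simp add: double_basis_def subfield_0)
  next
    case False
    then have bi: "b (i - n) \<in> K" using that basis_mem[OF b] by simp
    have "double_basis n b ?\<eta> i = b (i - n) * u / 2 + b (i - n) / 2 * s"
      using False by (simp add: double_basis_def field_simps)
    also have "\<dots> \<in> quad_ext K s"
      using bi u sf subfield_of_int[OF sf, of 2] by (intro quad_extI) (auto intro!: subfield_divide subfield_mult)
    finally show ?thesis .
  qed
  show ?thesis
    using gram_det_change_basis[OF number_field_quad_ext(1)[OF K s] mem eq] det by simp
qed

lemma discriminant_quad_ext:
  assumes K: "number_field K" and s: "s \<notin> K" and w: "s\<^sup>2 \<in> unit_group (ring_of_integers K)"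
    and u: "u \<in> ring_of_integers K" and cong: "cong_mod (ring_of_integers K) 4 (s\<^sup>2) (u\<^sup>2)"
  shows "\<bar>discriminant (quad_ext K s)\<bar> = \<bar>discriminant K\<bar>\<^sup>2"
proof -
  let ?K = "quad_ext K s" and ?\<eta> = "(u + s) / 2"
  have sf: "is_subfield K" using K by (simp add: number_field_def)
  have wK: "s\<^sup>2 \<in> K" and uK: "u \<in> K" using w u by (auto simp: unit_group_def ring_of_integers_def)
  obtain b where b: "integral_basis K b" using integral_basis_exists[OF K] .
  define n where "n = degree_of K"
  have b': "free_module_on \<int> (ring_of_integers K) {..<n} b"
    using b by (simp add: integral_basis_def n_def)
  have rb: "rat_basis K n b" by (rule integral_basis_rat_basis[OF K b'])
  have deg: "degree_of ?K = 2 * n" using number_field_quad_ext(2)[OF K s wK] by (simp add: n_def)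
  have direct: "x = 0 \<and> y = 0"
    if "x \<in> ring_of_integers K" "y \<in> ring_of_integers K" "x + y * ?\<eta> = 0" for x y
    using that ring_of_integers_direct[OF sf s uK] by blast
  have "integral_basis ?K (double_basis n b ?\<eta>)"
    unfolding integral_basis_def deg ring_of_integers_quad_ext[OF sf s w u cong]
    using b' direct by (rule free_module_on_double_basis)
  then have "discriminant ?K = gram_det ?K (2 * n) (double_basis n b ?\<eta>)"
    using discriminant_eq[OF number_field_quad_ext(1)[OF K s wK]] deg by simp
  moreover have "discriminant K = gram_det K n b"
    using discriminant_eq[OF K b] by (simp add: n_def)
  \<comment> \<open>Both sides are the absolute Gram determinant of \<open>b, b s\<close>; the
    common factor is cancelled at the end.\<close>
  moreover have "(2 ^ n)\<^sup>2 * \<bar>gram_det ?K (2 * n) (double_basis n b ?\<eta>)\<bar> =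
      (2 ^ n)\<^sup>2 * \<bar>gram_det K n b\<bar>\<^sup>2"
  proof -
    have "(2 ^ n)\<^sup>2 * \<bar>gram_det ?K (2 * n) (double_basis n b ?\<eta>)\<bar> =
      \<bar>gram_det ?K (2 * n) (double_basis n b s)\<bar>"
      unfolding gram_det_double_basis_shift[OF K s wK rb uK] by (simp add: abs_mult)
    also have "gram_det ?K (2 * n) (double_basis n b s) = (2 ^ n)\<^sup>2 * gram_det K n b *
        det (mat n n (\<lambda>(i, j). field_trace K (s\<^sup>2 * b i * b j)))"
      using basis_mem[OF rb] by (rule gram_det_double_basis[OF K s wK])
    also have "\<bar>\<dots>\<bar> = (2 ^ n)\<^sup>2 * \<bar>gram_det K n b\<bar>\<^sup>2"
      unfolding abs_mult gram_det_unit_mult[OF K b' w] by (simp add: power2_eq_square)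
    finally show ?thesis .
  qed
  ultimately show ?thesis by simp
qed

section \<open>Adjoining several square roots\<close>

lemma subset_adjoin: "K \<subseteq> adjoin K S"
  and generators_subset_adjoin: "S \<subseteq> adjoin K S"
  by (auto simp: adjoin_def)

lemma adjoin_minimal: "is_subfield F \<Longrightarrow> K \<subseteq> F \<Longrightarrow> S \<subseteq> F \<Longrightarrow> adjoin K S \<subseteq> F"
  by (auto simp: adjoin_def)

lemma adjoin_absorb: "is_subfield K \<Longrightarrow> S \<subseteq> K \<Longrightarrow> adjoin K S = K"
  using adjoin_minimal[of K K S] subset_adjoin[of K S] by blast

lemma adjoin_insert: "adjoin K (insert a S) = adjoin (adjoin K S) {a}"
proof
  have "K \<subseteq> adjoin (adjoin K S) {a}" "insert a S \<subseteq> adjoin (adjoin K S) {a}"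
    using subset_adjoin[of K S] generators_subset_adjoin[of S K]
      subset_adjoin[of "adjoin K S" "{a}"] generators_subset_adjoin[of "{a}" "adjoin K S"] by auto
  then show "adjoin K (insert a S) \<subseteq> adjoin (adjoin K S) {a}"
    by (intro adjoin_minimal adjoin_subfield)
  have "adjoin K S \<subseteq> adjoin K (insert a S)"
    using subset_adjoin[of K "insert a S"] generators_subset_adjoin[of "insert a S" K] by (intro adjoin_minimal adjoin_subfield) auto
  then show "adjoin (adjoin K S) {a} \<subseteq> adjoin K (insert a S)"
    using subset_adjoin[of K "insert a S"] generators_subset_adjoin[of "insert a S" K] by (intro adjoin_minimal adjoin_subfield) auto
qed

text \<open>If \<open>(p + q \<surd>w)\<^sup>2\<close> lies in the base field, then \<open>p = 0\<close> or \<open>q = 0\<close>.\<close>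

lemma square_in_adjoin_square_roots:
  fixes L :: "'a::field_char_0 set"
  assumes L: "is_subfield L" and A: "finite A"
    and s: "\<And>i. i \<in> A \<Longrightarrow> s i ^ 2 = w i" and w: "\<And>i. i \<in> A \<Longrightarrow> w i \<in> L" "\<And>i. i \<in> A \<Longrightarrow> w i \<noteq> 0"
    and y: "y \<in> adjoin L (s ` A)" "y\<^sup>2 \<in> L"
  shows "\<exists>v\<in>L. \<exists>T\<subseteq>A. y\<^sup>2 = v\<^sup>2 * (\<Prod>i\<in>T. w i)"
  using A s w y
proof (induction A arbitrary: y rule: finite_induct)
  case empty
  then show ?case using L by (auto simp: adjoin_absorb)
next
  case (insert a A)
  define K where "K = adjoin L (s ` A)"
  have K: "is_subfield K" by (simp add: K_def adjoin_subfield)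
  have LK: "L \<subseteq> K" by (simp add: K_def subset_adjoin)
  have IH: "\<exists>v\<in>L. \<exists>T\<subseteq>A. z\<^sup>2 = v\<^sup>2 * (\<Prod>i\<in>T. w i)" if "z \<in> K" "z\<^sup>2 \<in> L" for z
    by (rule insert.IH) (use that insert.prems(1-3) in \<open>simp_all add: K_def\<close>)
  have y: "y \<in> adjoin K {s a}"
    using insert.prems(4) unfolding image_insert adjoin_insert[of L] K_def[symmetric] .
  have wa: "s a ^ 2 = w a" "w a \<in> L" "w a \<noteq> 0" using insert.prems(1-3) by auto
  have sub: "T \<subseteq> insert a A" if "T \<subseteq> A" for T using that by blast
  show ?case
  proof (cases "s a \<in> K")
    case True
    then have "y \<in> K" using y K by (simp add: adjoin_absorb)
    then show ?thesis using IH insert.prems(5) sub by meson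
  next
    case False
    have "y \<in> quad_ext K (s a)"
      using y adjoin_eq_quad_ext[OF K False] wa LK by auto
    then obtain p q where pq: "p \<in> K" "q \<in> K" "y = p + q * s a" by (rule quad_extE)
    have y2: "y\<^sup>2 = p\<^sup>2 + q\<^sup>2 * w a + 2 * p * q * s a"
      unfolding pq(3) wa(1)[symmetric] by (simp add: power2_eq_square algebra_simps)
    \<comment> \<open>As \<open>y\<^sup>2\<close> already lies in \<open>K\<close>, the coefficient
      \<open>2 * p * q\<close> of \<open>s a\<close> must vanish.\<close>
    have "(p\<^sup>2 + q\<^sup>2 * w a - y\<^sup>2) + 2 * p * q * s a = 0" using y2 by simp
    moreover have "p\<^sup>2 + q\<^sup>2 * w a - y\<^sup>2 \<in> K" "2 * p * q \<in> K"
      using pq(1,2) wa(2) LK K insert.prems(5) subfield_of_int[OF K, of 2]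
      by (auto intro!: subfield_add subfield_diff[OF K] subfield_mult intro: subfield_power)
    ultimately have "2 * p * q = 0" using quad_ext_direct[OF K False] by blast
    then consider "q = 0" | "p = 0" by auto
    then show ?thesis
    proof cases
      case 1
      then have "y \<in> K" using pq by simp
      then show ?thesis using IH insert.prems(5) sub by meson
    next
      case 2
      \<comment> \<open>Here \<open>y = q * s a\<close>, to which the induction hypothesis need not
        apply; but \<open>q * w a = y * s a\<close> lies in \<open>K\<close> and its square lies in
        \<open>L\<close>.\<close>
      have yw: "(q * w a)\<^sup>2 = y\<^sup>2 * w a" using y2 2 by (simp add: power2_eq_square)
      moreover have "y\<^sup>2 * w a \<in> L" "q * w a \<in> K"
        using pq wa LK K L insert.prems(5) by (auto intro!: subfield_mult)
      ultimately obtain v T where vT: "v \<in> L" "T \<subseteq> A" "(q * w a)\<^sup>2 = v\<^sup>2 * (\<Prod>i\<in>T. w i)"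
        using IH[of "q * w a"] by auto
      have "finite T" "a \<notin> T" using vT(2) insert.hyps finite_subset by auto
      \<comment> \<open>The surplus factor \<open>w a\<close> is moved into the product by adding
        \<open>a\<close> to \<open>T\<close>, at the cost of dividing \<open>v\<close> by
        \<open>w a\<close>.\<close>
      have "y\<^sup>2 = y\<^sup>2 * w a * w a / (w a)\<^sup>2" using wa(3) by (simp add: power2_eq_square)
      also have "\<dots> = (v / w a)\<^sup>2 * (\<Prod>i\<in>insert a T. w i)"
        unfolding yw[symmetric] vT(3) using \<open>finite T\<close> \<open>a \<notin> T\<close> by (simp add: power_divide)
      finally have "y\<^sup>2 = (v / w a)\<^sup>2 * (\<Prod>i\<in>insert a T. w i)" .
      moreover have "v / w a \<in> L" "insert a T \<subseteq> insert a A"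
        using vT wa L by (auto intro: subfield_divide)
      ultimately show ?thesis by blast
    qed
  qed
qed

section \<open>Units and their square roots\<close>

lemma unit_group_prod:
  assumes "is_subfield L" "\<And>i. i \<in> T \<Longrightarrow> w i \<in> unit_group (ring_of_integers L)"
  shows "(\<Prod>i\<in>T. w i) \<in> unit_group (ring_of_integers L)"
proof -
  have one: "1 \<in> unit_group (ring_of_integers L)"
    using assms(1) by (auto simp: unit_group_def ring_of_integers_1 intro!: bexI[of _ 1])
  have mult: "x * y \<in> unit_group (ring_of_integers L)"
    if xy: "x \<in> unit_group (ring_of_integers L)" "y \<in> unit_group (ring_of_integers L)" for x y
  proof -
    obtain x' y' where inv: "x' \<in> ring_of_integers L" "x * x' = 1" "y' \<in> ring_of_integers L" "y * y' = 1"
      using xy by (auto simp: unit_group_def)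
    have "(x * y) * (x' * y') = (x * x') * (y * y')" by (simp only: mult_ac)
    then have "(x * y) * (x' * y') = 1" using inv by simp
    then show ?thesis
      using xy inv assms(1) unfolding unit_group_def by (auto intro!: ring_of_integers_mult)
  qed
  show ?thesis
    using assms(2) by (induction T rule: infinite_finite_induct) (auto simp: one mult)
qed

text \<open>If \<open>x\<close> inverts \<open>v\<^sup>2\<close>, then \<open>v * x\<close> inverts
  \<open>v\<close>; and \<open>v\<close> is integral as a root of \<open>T^2 - v^2\<close>. This
  turns a square root found in \<open>L\<close> into a unit, as the hypothesis on the products
  requires.\<close>

lemma unit_group_sqrt:
  fixes L :: "'a::field_char_0 set"
  assumes L: "is_subfield L" and v: "v \<in> L" "v\<^sup>2 \<in> unit_group (ring_of_integers L)"
  shows "v \<in> unit_group (ring_of_integers L)"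
proof -
  obtain x where x: "x \<in> ring_of_integers L" "v\<^sup>2 * x = 1" and v2: "v\<^sup>2 \<in> ring_of_integers L"
    using v(2) by (auto simp: unit_group_def)
  have "algebraic_int v"
    by (rule algebraic_int_quadratic[of 0 "v\<^sup>2"]) (use v2 in \<open>auto simp: ring_of_integers_def\<close>)
  then have "v \<in> ring_of_integers L" using v(1) by (simp add: ring_of_integers_def)
  moreover from this have "v * x \<in> ring_of_integers L" by (rule ring_of_integers_mult[OF L _ x(1)])
  moreover have "v * (v * x) = 1" using x(2) by (simp add: power2_eq_square mult.assoc)
  ultimately show ?thesis by (auto simp: unit_group_def)
qed

lemma root_discriminant_double_degree:
  assumes "\<bar>discriminant K'\<bar> = \<bar>discriminant K\<bar>\<^sup>2" "degree_of K' = 2 * degree_of K"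
  shows "root_discriminant K' = root_discriminant K"
proof -
  define x where "x = real_of_rat \<bar>discriminant K\<bar>"
  have "real_of_rat \<bar>discriminant K'\<bar> = x powr 2"
    unfolding assms(1) of_rat_power x_def by simp
  then have "root_discriminant K' = (x powr 2) powr (1 / (2 * real (degree_of K)))"
    by (simp add: root_discriminant_def assms(2))
  also have "\<dots> = x powr (1 / real (degree_of K))"
    by (simp only: powr_powr) simp
  finally show ?thesis by (simp add: root_discriminant_def x_def)
qed

text \<open>The induction carries \<open>number_field\<close> along because each step takes the
  field reached so far as its base. Units and congruences pass from \<open>L\<close> to that field,
  whereas the hypothesis on products stays over \<open>L\<close> and is used there through Kummer
  theory; freeness is likewise always over \<open>O_L\<close>.\<close>

lemma adjoin_square_roots:
  fixes L :: "'a::field_char_0 set" and w s :: "'i \<Rightarrow> 'a"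
  assumes L: "number_field L" and A: "finite A"
    and unit: "\<And>i. i \<in> A \<Longrightarrow> w i \<in> unit_group (ring_of_integers L)"
    and square_class: "\<And>i. i \<in> A \<Longrightarrow> square_unit_class (ring_of_integers L) 4 (w i)"
    and nonsquare: "\<And>T. T \<subseteq> A \<Longrightarrow> T \<noteq> {} \<Longrightarrow>
      \<not> (\<exists>v\<in>unit_group (ring_of_integers L). (\<Prod>i\<in>T. w i) = v ^ 2)"
    and s: "\<And>i. i \<in> A \<Longrightarrow> s i ^ 2 = w i"
  shows "number_field (adjoin L (s ` A)) \<and> root_discriminant (adjoin L (s ` A)) = root_discriminant L \<and>
    ((\<forall>i\<in>A. cong_mod (ring_of_integers L) 4 (w i) 1) \<longrightarrow>
      free_module_on (ring_of_integers L) (ring_of_integers (adjoin L (s ` A))) (Pow A)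
        (\<lambda>T. \<Prod>i\<in>T. (1 + s i) / 2))"
  using A unit square_class nonsquare s
proof (induction A rule: finite_induct)
  case empty
  have sf: "is_subfield L" using L by (simp add: number_field_def)
  \<comment> \<open>The empty product \<open>\<eta>_{}\<close> is 1, on which \<open>O_L\<close> is
    free over itself.\<close>
  have "free_module_on (ring_of_integers L) (ring_of_integers L) {{}} (\<lambda>T. \<Prod>i\<in>T. (1 + s i) / 2)"
    unfolding free_module_on_def by (auto intro: exI[of _ "\<lambda>_. _"])
  then show ?case using L sf by (simp add: adjoin_absorb)
next
  case (insert a A)
  define K where "K = adjoin L (s ` A)"
  have sfL: "is_subfield L" using L by (simp add: number_field_def)
  have LK: "L \<subseteq> K" by (simp add: K_def subset_adjoin)
  then have OLK: "ring_of_integers L \<subseteq> ring_of_integers K" by (rule ring_of_integers_mono)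
  have IH: "number_field K" "root_discriminant K = root_discriminant L"
    "(\<forall>i\<in>A. cong_mod (ring_of_integers L) 4 (w i) 1) \<Longrightarrow>
      free_module_on (ring_of_integers L) (ring_of_integers K) (Pow A) (\<lambda>T. \<Prod>i\<in>T. (1 + s i) / 2)"
    using insert.IH insert.prems unfolding K_def by blast+
  have sf: "is_subfield K" using IH(1) by (simp add: number_field_def)
  have unit: "w i \<in> unit_group (ring_of_integers L)" if "i \<in> insert a A" for i
    using insert.prems(1) that .
  then have wL: "w i \<in> L" "w i \<noteq> 0" if "i \<in> insert a A" for i
    using that by (force simp: unit_group_def ring_of_integers_def)+
  have sa: "s a ^ 2 = w a" using insert.prems(4) by simp
  have notin: "s a \<notin> K"
  proof
    assume "s a \<in> K"
    then obtain v T where vT: "v \<in> L" "T \<subseteq> A" "(s a)\<^sup>2 = v\<^sup>2 * (\<Prod>i\<in>T. w i)"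
      using square_in_adjoin_square_roots[OF sfL insert.hyps(1), of s w "s a"] insert.prems(4) wL
      unfolding K_def sa by auto
    have T: "finite T" "a \<notin> T" "insert a T \<subseteq> insert a A" "insert a T \<noteq> {}"
      using vT(2) insert.hyps finite_subset by auto
    \<comment> \<open>From \<open>w a = v^2 * P\<close>, with \<open>P\<close> the product over
      \<open>T\<close>, it follows that \<open>w a * P = (v * P)^2\<close>: the product over
      \<open>insert a T\<close> is a square.\<close>
    define x where "x = v * (\<Prod>i\<in>T. w i)"
    have "(\<Prod>i\<in>insert a T. w i) = x\<^sup>2"
      using T vT(3) sa by (simp add: x_def power2_eq_square mult_ac)
    moreover have "x \<in> L" unfolding x_def using vT wL sfL by (intro subfield_mult subfield_prod) auto
    moreover have "(\<Prod>i\<in>insert a T. w i) \<in> unit_group (ring_of_integers L)"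
      using T unit by (intro unit_group_prod[OF sfL]) auto
    ultimately have "x \<in> unit_group (ring_of_integers L)"
      using unit_group_sqrt[OF sfL] by simp
    then show False using insert.prems(3)[OF T(3,4)] \<open>(\<Prod>i\<in>insert a T. w i) = x\<^sup>2\<close> by blast
  qed
  have unitK: "(s a)\<^sup>2 \<in> unit_group (ring_of_integers K)"
    unfolding sa using unit[of a] unit_group_mono[OF OLK] by auto
  have saK: "(s a)\<^sup>2 \<in> K" using sa wL LK by auto
  have congK: "cong_mod (ring_of_integers K) 4 x y" if "cong_mod (ring_of_integers L) 4 x y" for x y
    using that OLK by (auto simp: cong_mod_def)
  have N: "adjoin L (s ` insert a A) = quad_ext K (s a)"
    unfolding image_insert adjoin_insert[of L] K_def[symmetric] by (rule adjoin_eq_quad_ext[OF sf notin saK])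
  obtain u where u: "u \<in> ring_of_integers L" "cong_mod (ring_of_integers L) 4 (w a) (u\<^sup>2)"
    using insert.prems(2)[of a] by (auto simp: square_unit_class_def)
  have "\<bar>discriminant (quad_ext K (s a))\<bar> = \<bar>discriminant K\<bar>\<^sup>2"
    using u OLK congK by (intro discriminant_quad_ext[OF IH(1) notin unitK, of u]) (auto simp: sa)
  then have "root_discriminant (quad_ext K (s a)) = root_discriminant L"
    using root_discriminant_double_degree number_field_quad_ext(2)[OF IH(1) notin saK] IH(2) by metis
  moreover have "free_module_on (ring_of_integers L) (ring_of_integers (quad_ext K (s a))) (Pow (insert a A))
      (\<lambda>T. \<Prod>i\<in>T. (1 + s i) / 2)"
    if cong: "\<forall>i\<in>insert a A. cong_mod (ring_of_integers L) 4 (w i) 1"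
  proof -
    \<comment> \<open>When \<open>w a\<close> is congruent to 1, the choice \<open>u = 1\<close> is
      possible and gives exactly the factor \<open>(1 + s a) / 2\<close> of
      \<open>\<eta>_T\<close>.\<close>
    have one: "1 \<in> ring_of_integers K" by (rule ring_of_integers_1[OF sf])
    have "ring_of_integers (quad_ext K (s a)) = quad_ext (ring_of_integers K) ((1 + s a) / 2)"
      using cong congK by (intro ring_of_integers_quad_ext[OF sf notin unitK one]) (simp add: sa)
    moreover have "free_module_on (ring_of_integers L) (quad_ext (ring_of_integers K) ((1 + s a) / 2))
        (Pow A \<union> insert a ` Pow A) (\<lambda>T. \<Prod>i\<in>T. (1 + s i) / 2)"
    proof (rule free_module_on_quad_ext[OF IH(3)])
      show "inj_on (insert a) (Pow A)" "Pow A \<inter> insert a ` Pow A = {}"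
        using insert.hyps by (auto simp: inj_on_def)
      show "x = 0 \<and> y = 0"
        if "x \<in> ring_of_integers K" "y \<in> ring_of_integers K" "x + y * ((1 + s a) / 2) = 0" for x y
        using ring_of_integers_direct[OF sf notin subfield_1[OF sf] that] .
      fix T assume "T \<in> Pow A"
      then have "finite T" "a \<notin> T" using insert.hyps finite_subset by auto
      then show "(\<Prod>i\<in>insert a T. (1 + s i) / 2) = (\<Prod>i\<in>T. (1 + s i) / 2) * ((1 + s a) / 2)"
        by (simp only: prod.insert mult.commute not_False_eq_True)
    qed (use insert.hyps cong in auto)
    ultimately show ?thesis by (simp only: Pow_insert)
  qed
  ultimately show ?case
    using number_field_quad_ext(1)[OF IH(1) notin saK] unfolding N by blast
qed

theorem theorem2p8:
  fixes L :: "'a::field_char_0 set" and m :: nat and w s :: "nat \<Rightarrow> 'a" and N :: "'a set"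
  assumes "number_field L"
    and "\<forall>i\<in>{1..m}. w i \<in> unit_group (ring_of_integers L)"
    and "\<forall>i\<in>{1..m}. square_unit_class (ring_of_integers L) 4 (w i)"
    and "\<forall>T. T \<subseteq> {1..m} \<and> T \<noteq> {} \<longrightarrow>
           \<not> (\<exists>v\<in>unit_group (ring_of_integers L). (\<Prod>i\<in>T. w i) = v ^ 2)"
    and "\<forall>i\<in>{1..m}. s i ^ 2 = w i"
    and "N = adjoin L (s ` {1..m})"
  shows "root_discriminant N = root_discriminant L \<and>
         ((\<forall>i\<in>{1..m}. cong_mod (ring_of_integers L) 4 (w i) 1) \<longrightarrow>
           free_module_on (ring_of_integers L) (ring_of_integers N) (Pow {1..m})
             (\<lambda>T. \<Prod>i\<in>T. (1 + s i) / 2))"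
  using adjoin_square_roots[of L "{1..m}" w s] assms by simp

end
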